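(* Suppose that the following conditions hold. (1) There are a sequence of positive numbers $(\epsilon(r))_{r\in\mathbb N}$ with $\lim_{r\to\infty}\epsilon(r)=0$ and positive random variables $\eta(r)$ with $\lim_{r\to\infty}\eta(r)=0$ a.s. such that for every sequence $\mathcal T\in\mathfrak T$, $$P_{\mathcal C}\big[S_T(r,\epsilon(r))\big]\Psi_T\le\eta(r)\quad\text{a.s.}\qquad(T\in\mathcal T,\ r\in\mathbb N).$$ (2) For every $\epsilon>0$, $c>0$ and $\mathcal T\in\mathfrak T$, $\ \limsup_{T\to\infty,\,T\in\mathcal T}P_{\mathcal C}[W_T(\delta,c,\epsilon)]\Psi_T\to^P 0$ as $\delta\downarrow0$. (3) (i) For any $k\in\mathbb N$, $u_1,\dots,u_k\in\mathbb R^{\mathsf p}$, $f\in C_b(\mathbb R^{k})$ and any bounded $\mathcal G$-measurable random variable $Y$, $$E_{\mathcal C}\big[f\big((\mathbb Z_T(u_i))_{i=1,\dots,k}\big)\Psi_TY\big]\to^P\overline E_{\mathcal C}\big[f\big((\mathbb Z(u_i))_{i=1,\dots,k}\big)Y\big]\quad(T\to\infty);$$ (ii) $\Psi_T\to^P1$ as $T\to\infty$. (4) With probability one, there exists a unique element $\hat u\in\mathbb R^{\mathsf p}$ that maximizes $\mathbb Z$. Then $$E_{\mathcal C}[f(\hat u_T)Y]\to^P\overline E_{\mathcal C}[f(\hat u)Y]\quad(T\to\infty)$$ for any $f\in C_b(\mathbb R^{\mathsf p})$ and any bounded $\mathcal G$-measurable random variable $Y$. In particular, $\hat u_T\to^{d_s(\mathcal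 G)}\hat u$ as $T\to\infty$.
   Context: $(\Omega,\mathcal F,P)$ is a probability space, $\mathbb T\subset[0,\infty)$ with $\sup\mathbb T=\infty$, $\Theta$ is a bounded domain in $\mathbb R^{\mathsf p}$ with closure $\overline\Theta$, and $\theta^*\in\Theta$. For $T\in\mathbb T$, $\mathbb H_T:\Omega\times\overline\Theta\to\mathbb R$ is a jointly measurable random field, continuous in $\theta\in\overline\Theta$ for every $\omega$. The matrices $a_T\in GL(\mathbb R^{\mathsf p})$ satisfy $a_T\to0$ as $T\to\infty$. Put $\theta_T^\dagger(u)=\theta^*+a_Tu$, $\mathbb U_T=\{u\in\mathbb R^{\mathsf p}:\theta_T^\dagger(u)\in\Theta\}$ and $\mathbb Z_T(u)=\exp\big(\mathbb H_T(\theta_T^\dagger(u))-\mathbb H_T(\theta^* )\big)$ for $u\in\mathbb U_T$. The field $\mathbb Z_T$ is extended to $\mathbb R^{\mathsf p}$ as a (measurable, nonnegative) continuous random field with compact support and $\sup_{u\in\mathbb R^{\mathsf p}\setminus\mathbb U_T}\mathbb Z_T(u)\le\max_{u\in\partial\mathbb U_T}\mathbb Z_T(u)$; the extension is also denoted $\mathbb Z_T$. $\hat C=\{f\in C(\mathbb R^{\mathsf p}):\lim_{|u|\to\infty}f(u)=0\}$ with the supremum norm. A quasi maximum likelihood estimator is a measurable map $\hat\theta_T:\Omega\to\overline\Theta$ with $\mathbb H_T(\hat\theta_T)=\max_{\theta\in\overline\Theta}\mathbb H_T(\theta)$ for all $\omega$; $\hat u_T=a_T^{-1}(\hat\theta_T-\theta^*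 )$. $\mathcal C\subset\mathcal G\subset\mathcal F$ are $\sigma$-fields; $P_{\mathcal C}$, $E_{\mathcal C}$ denote conditional probability and expectation given $\mathcal C$. $\Psi_T$ ($T\in\mathbb T$) are $[0,1]$-valued $\mathcal C$-measurable random variables. $T_0>0$ is fixed, and $\mathfrak T$ is the set of sequences $(T_n)_{n\in\mathbb N}$ in $\mathbb T$ with $T_n\ge T_0$ for all $n$ and $T_n\to\infty$. $\mathbb V_T(r)=\{u\in\mathbb U_T:|u|\ge r\}$ and $S_T(r,\epsilon)=\{\sup_{u\in\mathbb V_T(r)}\mathbb Z_T(u)\ge\epsilon\}$ (the supremum over the empty set being $0$). For $c>0$, $B_{c,T}=\{u\in\mathbb R^{\mathsf p}:|u|<c,\ \theta_T^\dagger(u)\in\Theta\}$, $w_T(\delta,c)=\sup\{|\log\mathbb Z_T(u_2)-\log\mathbb Z_T(u_1)|:u_1,u_2\in B_{c,T},|u_2-u_1|\le\delta\}$, and $W_T(\delta,c,\epsilon)=\{w_T(\delta,c)>\epsilon\}$. $(\overline\Omega,\overline{\mathcal F},\overline P)$ is an extension of $(\Omega,\mathcal F,P)$ (random variables on $\Omega$ are regarded as random variables on $\overline\Omega$, and $\overline P|_{\mathcal F}=P$), with conditional expectation $\overline E_{\mathcal C}$ given $\mathcal C$; $\mathbb Z$ is a $\hat C$-valued random variable on it, and $\hat u$ is taken $\overline{\mathcal F}$-measurable. $\to^P$ is convergence in probability. $\hat u_T\to^{d_s(\mathcal G)}\hat u$ ($\mathcal G$-stable convergence) means $E[f(\hat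 u_T)Y]\to\overline E[f(\hat u)Y]$ for all $f\in C_b(\mathbb R^{\mathsf p})$ and all bounded $\mathcal G$-measurable $Y$. *)

theory Defs
  imports "HOL-Probability.Probability"
begin

abbreviation at_top_in :: "real set \<Rightarrow> real filter" where
  "at_top_in TT \<equiv> inf at_top (principal TT)"

text \<open>Only applied below to measurable \<open>X i\<close> and \<open>Y\<close>.\<close>

definition tendsto_in_prob ::
    "'w measure \<Rightarrow> ('i \<Rightarrow> 'w \<Rightarrow> real) \<Rightarrow> ('w \<Rightarrow> real) \<Rightarrow> 'i filter \<Rightarrow> bool" where
  "tendsto_in_prob N X Y F \<longleftrightarrow>
     (\<forall>e>0. ((\<lambda>i. measure N {\<omega> \<in> space N. \<bar>X i \<omega> - Y \<omega>\<bar> > e}) \<longlongrightarrow> 0) F)"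

definition cond_probability :: "'a measure \<Rightarrow> 'a measure \<Rightarrow> 'a set \<Rightarrow> 'a \<Rightarrow> real" where
  "cond_probability M C A = real_cond_exp M C (indicat_real A)"

text \<open>An extension of a probability space \<open>M\<close> is a probability space \<open>Mb\<close> with a
  measure-preserving map \<open>pr\<close> to \<open>M\<close>. A random variable \<open>X\<close> on \<open>M\<close> is regarded as the random
  variable \<open>\<lambda>w. X (pr w)\<close> on \<open>Mb\<close>, and a sub-sigma-field \<open>C\<close> of \<open>M\<close> as its preimage under \<open>pr\<close>.
  \<open>pr\<close> need not be surjective.\<close>

definition prob_extension :: "'a measure \<Rightarrow> 'b measure \<Rightarrow> ('b \<Rightarrow> 'a) \<Rightarrow> bool" where
  "prob_extension M Mb pr \<longleftrightarrow> prob_space Mb \<and> pr \<in> measurable Mb M \<and> distr Mb M pr = M"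

definition ext_cond_exp ::
    "'b measure \<Rightarrow> ('b \<Rightarrow> 'a) \<Rightarrow> 'a measure \<Rightarrow> ('b \<Rightarrow> real) \<Rightarrow> 'b \<Rightarrow> real" where
  "ext_cond_exp Mb pr C g = real_cond_exp Mb (vimage_algebra (space Mb) pr C) g"

text \<open>The continuous functions vanishing at infinity, with the supremum norm inherited from the
  type of bounded continuous functions.\<close>

definition C_hat :: "((real ^ 'p) \<Rightarrow>\<^sub>C real) set" where
  "C_hat = {f. (apply_bcontfun f \<longlongrightarrow> 0) at_infinity}"

definition admissible_seqs :: "real set \<Rightarrow> real \<Rightarrow> (nat \<Rightarrow> real) set" where
  "admissible_seqs TT T0 =
     {\<tau>. (\<forall>n. \<tau> n \<in> TT \<and> T0 \<le> \<tau> n) \<and> filterlim \<tau> at_top sequentially}"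

text \<open>In the following, \<open>A\<close> stands for the matrix \<open>a T\<close> and \<open>Z\<close> for the random field
  \<open>Z\<^sub>T\<close>.\<close>

definition theta_dagger :: "real ^ 'p \<Rightarrow> real ^ 'p ^ 'p \<Rightarrow> real ^ 'p \<Rightarrow> real ^ 'p" where
  "theta_dagger \<theta>s A u = \<theta>s + A *v u"

definition U_set :: "(real ^ 'p) set \<Rightarrow> real ^ 'p \<Rightarrow> real ^ 'p ^ 'p \<Rightarrow> (real ^ 'p) set" where
  "U_set \<Theta> \<theta>s A = {u. theta_dagger \<theta>s A u \<in> \<Theta>}"

definition V_set :: "(real ^ 'p) set \<Rightarrow> real ^ 'p \<Rightarrow> real ^ 'p ^ 'p \<Rightarrow> real \<Rightarrow> (real ^ 'p) set" where
  "V_set \<Theta> \<theta>s A r = {u \<in> U_set \<Theta> \<theta>s A. norm u \<ge> r}"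

text \<open>The real supremum, with the convention that it is 0 over the empty set.\<close>

definition sup0 :: "'x set \<Rightarrow> ('x \<Rightarrow> real) \<Rightarrow> real" where
  "sup0 X f = (if X = {} then 0 else (SUP x\<in>X. f x))"

definition S_event ::
    "'a measure \<Rightarrow> (real ^ 'p) set \<Rightarrow> real ^ 'p \<Rightarrow> real ^ 'p ^ 'p \<Rightarrow> ('a \<Rightarrow> real ^ 'p \<Rightarrow> real)
      \<Rightarrow> real \<Rightarrow> real \<Rightarrow> 'a set" where
  "S_event M \<Theta> \<theta>s A Z r \<epsilon> = {\<omega> \<in> space M. sup0 (V_set \<Theta> \<theta>s A r) (Z \<omega>) \<ge> \<epsilon>}"

definition B_set :: "(real ^ 'p) set \<Rightarrow> real ^ 'p \<Rightarrow> real ^ 'p ^ 'p \<Rightarrow> real \<Rightarrow> (real ^ 'p) set" where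
  "B_set \<Theta> \<theta>s A c = {u. norm u < c \<and> theta_dagger \<theta>s A u \<in> \<Theta>}"

definition w_modulus ::
    "(real ^ 'p) set \<Rightarrow> real ^ 'p \<Rightarrow> real ^ 'p ^ 'p \<Rightarrow> (real ^ 'p \<Rightarrow> real) \<Rightarrow> real \<Rightarrow> real \<Rightarrow> real" where
  "w_modulus \<Theta> \<theta>s A z \<delta> c =
     (SUP (u1, u2) \<in> {(u1, u2). u1 \<in> B_set \<Theta> \<theta>s A c \<and> u2 \<in> B_set \<Theta> \<theta>s A c \<and> norm (u2 - u1) \<le> \<delta>}.
        \<bar>ln (z u2) - ln (z u1)\<bar>)"

definition W_event ::
    "'a measure \<Rightarrow> (real ^ 'p) set \<Rightarrow> real ^ 'p \<Rightarrow> real ^ 'p ^ 'p \<Rightarrow> ('a \<Rightarrow> real ^ 'p \<Rightarrow> real)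
      \<Rightarrow> real \<Rightarrow> real \<Rightarrow> real \<Rightarrow> 'a set" where
  "W_event M \<Theta> \<theta>s A Z \<delta> c \<epsilon> = {\<omega> \<in> space M. w_modulus \<Theta> \<theta>s A (Z \<omega>) \<delta> c > \<epsilon>}"

definition is_qmle ::
    "'a measure \<Rightarrow> (real ^ 'p) set \<Rightarrow> ('a \<Rightarrow> real ^ 'p \<Rightarrow> real) \<Rightarrow> ('a \<Rightarrow> real ^ 'p) \<Rightarrow> bool" where
  "is_qmle M \<Theta> H \<theta>h \<longleftrightarrow>
     \<theta>h \<in> borel_measurable M \<and>
     (\<forall>\<omega>\<in>space M. is_arg_max (H \<omega>) (\<lambda>\<theta>. \<theta> \<in> closure \<Theta>) (\<theta>h \<omega>))"

text \<open>The extension to the whole space of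
  \<open>u \<mapsto> exp (H (theta_dagger \<theta>s A u) - H \<theta>s)\<close>, defined on \<open>U_set\<close>. The maximum over the
  (compact, nonempty) boundary is written as a supremum.\<close>

definition Z_extension ::
    "'a measure \<Rightarrow> (real ^ 'p) set \<Rightarrow> real ^ 'p \<Rightarrow> real ^ 'p ^ 'p \<Rightarrow> ('a \<Rightarrow> real ^ 'p \<Rightarrow> real)
      \<Rightarrow> ('a \<Rightarrow> real ^ 'p \<Rightarrow> real) \<Rightarrow> bool" where
  "Z_extension M \<Theta> \<theta>s A H Z \<longleftrightarrow>
     (\<lambda>(\<omega>, u). Z \<omega> u) \<in> borel_measurable (M \<Otimes>\<^sub>M borel) \<and>
     (\<forall>\<omega>\<in>space M.
        (\<forall>u\<in>U_set \<Theta> \<theta>s A. Z \<omega> u = exp (H \<omega> (theta_dagger \<theta>s A u) - H \<omega> \<theta>s)) \<and>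
        (\<forall>u. 0 \<le> Z \<omega> u) \<and>
        continuous_on UNIV (Z \<omega>) \<and>
        compact (closure {u. Z \<omega> u \<noteq> 0}) \<and>
        (SUP u\<in>- U_set \<Theta> \<theta>s A. Z \<omega> u) \<le> (SUP u\<in>frontier (U_set \<Theta> \<theta>s A). Z \<omega> u))"

definition stable_conv ::
    "'a measure \<Rightarrow> 'a measure \<Rightarrow> 'b measure \<Rightarrow> ('b \<Rightarrow> 'a) \<Rightarrow> ('i \<Rightarrow> 'a \<Rightarrow> real ^ 'p) \<Rightarrow> ('b \<Rightarrow> real ^ 'p)
      \<Rightarrow> 'i filter \<Rightarrow> bool" where
  "stable_conv M G Mb pr X Xlim F \<longleftrightarrow>
     (\<forall>(f :: real ^ 'p \<Rightarrow> real) Y.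
        continuous_on UNIV f \<longrightarrow> bounded (range f) \<longrightarrow>
        Y \<in> borel_measurable G \<longrightarrow> bounded (Y ` space G) \<longrightarrow>
        ((\<lambda>i. \<integral>\<omega>. f (X i \<omega>) * Y \<omega> \<partial>M) \<longlongrightarrow> (\<integral>w. f (Xlim w) * Y (pr w) \<partial>Mb)) F)"

end

theory Submission
  imports Defs
begin

text \<open>
The maximiser of a random field is not a continuous function of finitely many of its values, so
the convergence of finite-dimensional marginals does not transfer to it directly. What does work is
a bound from above. Let \<open>f\<close> be continuous with values in \<open>[0, K]\<close>, let
\<open>q\<^sub>0, q\<^sub>1, \<dots>\<close> be dense, and put \<open>x = arctan \<circ> z\<close> for a field \<open>z\<close>. Then
\<open>g(z) = max\<^sub>i\<^sub>\<le>\<^sub>m (f(q\<^sub>i) - b (max\<^sub>j\<^sub>\<le>\<^sub>m x(q\<^sub>j) - x(q\<^sub>i)))\<close>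
is a bounded continuous function of the values of \<open>z\<close> at \<open>m + 1\<close> points, and it relates to
the maximiser \<open>u\<close> of \<open>z\<close> in two ways.

First, \<open>f(u)\<close> hardly exceeds \<open>g(z)\<close> as soon as some \<open>q\<^sub>i\<close> lies close to \<open>u\<close> and
\<open>log z\<close> varies little between them (\<open>penalised_max_near_argmax\<close>). For \<open>z\<close> the field
at stage \<open>T\<close> this is what the hypotheses \<open>cond1\<close> on the tail and \<open>cond2\<close> on the modulus
provide: off the tail event the maximiser stays in a fixed ball, and off the modulus event \<open>log z\<close> varies little on that ball
(\<open>penalised_max_error_eventually_small\<close>). The conditional probabilities in them are
multiplied by variables that are measurable for the conditioning field, so taking expectations turns
them into plain bounds on the probabilities of the two events, weighted by \<open>\<Psi>\<close>.

Secondly, if \<open>z\<close> is continuous, vanishes at infinity and has a unique maximiser \<open>u\<close>, then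
\<open>g(z)\<close> hardly exceeds \<open>f(u)\<close> for a large penalty \<open>b\<close> and then a large \<open>m\<close>
(\<open>penalised_max_limit\<close>): the penalty excludes every point away from \<open>u\<close>. This applies to
the limit field by \<open>cond4\<close>. Vanishing at infinity helps only where the maximum is positive;
the value at the origin is 1 at every stage \<open>T\<close>, hence almost surely 1 in the limit.

Between the two stands the finite-dimensional convergence \<open>cond3i\<close>, by which the conditional
expectations of \<open>g\<close> converge. Together they show that the positive part of the difference between the conditional
expectations of \<open>f(u)\<close> at stage \<open>T\<close> and in the limit tends to 0 in mean
(\<open>cond_exp_limsup_from_above\<close>). Applying this to \<open>K - f\<close> as well bounds the negative part
(\<open>real_cond_exp_L1_if_one_sided\<close>). Convergence in mean gives both convergence in probability
and, by integrating, stable convergence. All of this is done on the extended space, along sequences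
of indices \<open>T\<close>.
\<close>

section \<open>Convergence in probability and in mean\<close>

text \<open>The filter has a countable base, so sequences detect its limits. The modulus hypothesis
  forces the passage to sequences, because its limit superior is taken along them.\<close>

lemma tendsto_at_top_in_if_admissible:
  fixes \<phi> :: "real \<Rightarrow> real"
  assumes "\<And>\<tau>. \<tau> \<in> admissible_seqs TT T0 \<Longrightarrow> (\<lambda>n. \<phi> (\<tau> n)) \<longlonglongrightarrow> l"
  shows "(\<phi> \<longlongrightarrow> l) (at_top_in TT)"
proof (rule tendstoI, rule ccontr)
  fix e :: real assume "e > 0" and "\<not> eventually (\<lambda>T. dist (\<phi> T) l < e) (at_top_in TT)"
  then have "\<exists>T. T \<in> TT \<and> T \<ge> N \<and> \<not> dist (\<phi> T) l < e" for N
    by (auto simp: eventually_inf_principal eventually_at_top_linorder)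
  then obtain s where s: "\<And>N. s N \<in> TT \<and> s N \<ge> N \<and> \<not> dist (\<phi> (s N)) l < e" by metis
  define \<tau> where "\<tau> n = s (max T0 (real n))" for n
  have le: "max T0 (real n) \<le> \<tau> n" for n
    using s by (simp add: \<tau>_def)
  have "filterlim \<tau> at_top sequentially"
    using filterlim_at_top_mono[OF filterlim_real_sequentially] le by (simp add: eventuallyI)
  then have "\<tau> \<in> admissible_seqs TT T0"
    using le s by (auto simp: admissible_seqs_def) (auto simp: \<tau>_def)
  then have "(\<lambda>n. \<phi> (\<tau> n)) \<longlonglongrightarrow> l" by (rule assms)
  then have "eventually (\<lambda>n. dist (\<phi> (\<tau> n)) l < e) sequentially" using \<open>e > 0\<close> by (rule tendstoD)
  then show False using s by (auto simp: \<tau>_def eventually_sequentially)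
qed

lemma admissible_seq_exists:
  assumes "\<not> bdd_above TT"
  shows "\<exists>\<tau>. \<tau> \<in> admissible_seqs TT T0"
proof -
  have "\<exists>T\<in>TT. max T0 (real n) \<le> T" for n using assms by (meson bdd_aboveI linear)
  then obtain \<tau> where \<tau>: "\<And>n. \<tau> n \<in> TT" "\<And>n. max T0 (real n) \<le> \<tau> n" by metis
  have "filterlim \<tau> at_top sequentially"
    using filterlim_at_top_mono[OF filterlim_real_sequentially] \<tau>(2) by (simp add: eventuallyI)
  then show ?thesis using \<tau> by (auto simp: admissible_seqs_def)
qed

lemma filterlim_admissible:
  "\<tau> \<in> admissible_seqs TT T0 \<Longrightarrow> filterlim \<tau> (at_top_in TT) sequentially"
  by (auto simp: admissible_seqs_def filterlim_inf filterlim_principal)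

text \<open>Only bounded conditional expectations occur below, and for these convergence in
  probability and in mean agree. Means are easier to add up and to move between the two probability
  spaces.\<close>

lemma tendsto_in_prob_bounded_imp_L1:
  fixes X :: "'i \<Rightarrow> 'w \<Rightarrow> real"
  assumes "prob_space N" and lim: "tendsto_in_prob N X Y F"
    and X: "eventually (\<lambda>i. X i \<in> borel_measurable N \<and> (AE w in N. \<bar>X i w - Y w\<bar> \<le> B)) F"
    and [measurable]: "Y \<in> borel_measurable N"
  shows "((\<lambda>i. \<integral>w. \<bar>X i w - Y w\<bar> \<partial>N) \<longlongrightarrow> 0) F"
proof (rule tendstoI)
  interpret prob_space N by fact
  fix e :: real assume e: "e > 0"
  define p where "p i = prob {w \<in> space N. \<bar>X i w - Y w\<bar> > e / 2}" for i
  have "(p \<longlongrightarrow> 0) F" using lim[unfolded tendsto_in_prob_def, rule_format, of "e / 2"] e unfolding p_def by simp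
  then have lim': "((\<lambda>i. e / 2 + \<bar>B\<bar> * p i) \<longlongrightarrow> e / 2 + \<bar>B\<bar> * 0) F" by (intro tendsto_intros)
  then have "eventually (\<lambda>i. e / 2 + \<bar>B\<bar> * p i < e) F" using order_tendstoD(2)[OF lim', of e] e by simp
  with X show "eventually (\<lambda>i. dist (\<integral>w. \<bar>X i w - Y w\<bar> \<partial>N) 0 < e) F"
  proof eventually_elim
    case (elim i)
    have [measurable]: "X i \<in> borel_measurable N" using elim by auto
    let ?A = "{w \<in> space N. \<bar>X i w - Y w\<bar> > e / 2}"
    have "(\<integral>w. \<bar>X i w - Y w\<bar> \<partial>N) \<le> (\<integral>w. e / 2 + \<bar>B\<bar> * indicator ?A w \<partial>N)"
    proof (rule integral_mono_AE)
      show "integrable N (\<lambda>w. \<bar>X i w - Y w\<bar>)"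
        using elim by (intro integrable_const_bound[where B = B]) auto
      show "AE w in N. \<bar>X i w - Y w\<bar> \<le> e / 2 + \<bar>B\<bar> * indicator ?A w"
        using conjunct2[OF elim(1)] AE_space by eventually_elim (use e in \<open>auto simp: indicator_def\<close>)
    qed (auto simp: emeasure_eq_measure)
    also have "\<dots> = e / 2 + \<bar>B\<bar> * p i"
      by (subst Bochner_Integration.integral_add) (auto simp: p_def prob_space emeasure_eq_measure)
    finally show ?case using elim by simp
  qed
qed

lemma L1_imp_tendsto_in_prob:
  fixes X :: "'i \<Rightarrow> 'w \<Rightarrow> real"
  assumes lim: "((\<lambda>i. \<integral>w. \<bar>X i w - Y w\<bar> \<partial>N) \<longlongrightarrow> 0) F"
    and X: "eventually (\<lambda>i. integrable N (\<lambda>w. X i w - Y w)) F"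
  shows "tendsto_in_prob N X Y F"
  unfolding tendsto_in_prob_def
proof (intro allI impI)
  fix e :: real assume e: "e > 0"
  have "((\<lambda>i. (\<integral>w. \<bar>X i w - Y w\<bar> \<partial>N) / e) \<longlongrightarrow> 0) F" using tendsto_divide[OF lim tendsto_const, of e] e by simp
  then show "((\<lambda>i. measure N {w \<in> space N. \<bar>X i w - Y w\<bar> > e}) \<longlongrightarrow> 0) F"
  proof (rule tendsto_sandwich[OF _ _ tendsto_const, rotated 2])
    show "eventually (\<lambda>i. measure N {w \<in> space N. \<bar>X i w - Y w\<bar> > e} \<le> (\<integral>w. \<bar>X i w - Y w\<bar> \<partial>N) / e) F"
      using X
    proof eventually_elim
      case (elim i)
      have [measurable]: "(\<lambda>w. X i w - Y w) \<in> borel_measurable N" using elim by auto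
      have I: "integrable N (\<lambda>w. \<bar>X i w - Y w\<bar>)" using elim by auto
      have "emeasure N {w \<in> space N. e \<le> \<bar>X i w - Y w\<bar>} \<noteq> \<infinity>"
        using integral_Markov_inequality[OF I _ e] by (auto simp: top_unique)
      then have "measure N {w \<in> space N. \<bar>X i w - Y w\<bar> > e} \<le> measure N {w \<in> space N. e \<le> \<bar>X i w - Y w\<bar>}"
        by (intro measure_mono_fmeasurable) (auto intro!: fmeasurableI simp: top.not_eq_extremum)
      also have "\<dots> \<le> (\<integral>w. \<bar>X i w - Y w\<bar> \<partial>N) / e"
        using I e by (intro integral_Markov_inequality_measure[where A = "{}"]) auto
      finally show ?case .
    qed
  qed auto
qed

section \<open>Conditional expectations on an extension\<close>

text \<open>Jensen's inequality for the positive part: it lets a one-sided bound on \<open>V\<close>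
  pass to the conditional expectation.\<close>

lemma (in sigma_finite_subalgebra) integral_pos_part_real_cond_exp_le:
  assumes "integrable M V"
  shows "(\<integral>x. max 0 (real_cond_exp M F V x) \<partial>M) \<le> (\<integral>x. max 0 (V x) \<partial>M)"
proof -
  have I: "integrable M (\<lambda>x. max 0 (V x))" using assms by auto
  have "(\<integral>x. max 0 (real_cond_exp M F V x) \<partial>M) \<le> (\<integral>x. real_cond_exp M F (\<lambda>x. max 0 (V x)) x \<partial>M)"
  proof (rule integral_mono_AE)
    show "AE x in M. max 0 (real_cond_exp M F V x) \<le> real_cond_exp M F (\<lambda>x. max 0 (V x)) x"
      using real_cond_exp_mono[OF _ assms I] real_cond_exp_pos[of "\<lambda>x. max 0 (V x)"] I by auto
  qed (use real_cond_exp_int(1) assms I in auto)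
  also have "\<dots> = (\<integral>x. max 0 (V x) \<partial>M)" by (rule real_cond_exp_int(2)[OF I])
  finally show ?thesis .
qed

lemma prob_space_imp_sigma_finite_subalgebra:
  "prob_space N \<Longrightarrow> subalgebra N F \<Longrightarrow> sigma_finite_subalgebra N F"
  by (intro finite_measure_subalgebra_is_sigma_finite)
    (simp add: finite_measure_subalgebra_def finite_measure_subalgebra_axioms_def prob_space.finite_measure)

lemma bounded_prob_integrable:
  fixes h :: "'w \<Rightarrow> real"
  assumes "prob_space N" "h \<in> borel_measurable N" "\<And>w. w \<in> space N \<Longrightarrow> \<bar>h w\<bar> \<le> b"
  shows "integrable N h"
proof -
  interpret prob_space N by fact
  show ?thesis using assms by (intro integrable_const_bound[where B = b]) auto
qed

lemma real_cond_exp_bounded: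
  assumes "prob_space N" "subalgebra N F" "h \<in> borel_measurable N" "\<And>w. w \<in> space N \<Longrightarrow> \<bar>h w\<bar> \<le> b"
  shows "AE w in N. \<bar>real_cond_exp N F h w\<bar> \<le> b"
proof -
  interpret F: sigma_finite_subalgebra N F using assms(1,2) by (rule prob_space_imp_sigma_finite_subalgebra)
  have i: "integrable N h" by (rule bounded_prob_integrable[OF assms(1,3,4)])
  have "AE w in N. real_cond_exp N F h w \<le> b" "AE w in N. - b \<le> real_cond_exp N F h w"
    using assms(4) by (intro F.real_cond_exp_le_c[OF i] F.real_cond_exp_ge_c[OF i] AE_I2; fastforce simp: abs_le_iff)+
  then show ?thesis by eventually_elim (simp add: abs_le_iff)
qed

lemma measurable_into_subalgebra:
  "subalgebra M C \<Longrightarrow> f \<in> measurable N M \<Longrightarrow> f \<in> measurable N C"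
  by (auto simp: measurable_def subalgebra_def)

lemma subalgebra_vimage:
  assumes "pr \<in> measurable Mb M" and "subalgebra M C"
  shows "subalgebra Mb (vimage_algebra (space Mb) pr C)"
proof -
  have "pr \<in> measurable Mb C" by (rule measurable_into_subalgebra[OF assms(2,1)])
  then show ?thesis
    by (auto simp: subalgebra_def sets_vimage_algebra2 measurable_space intro: measurable_sets
      dest: measurable_space)
qed

text \<open>Every set of the pulled-back field is a preimage, so that both sides integrate to the
  same value over it. This moves the whole problem onto the extended space.\<close>

lemma real_cond_exp_pullback:
  assumes M: "prob_space M" and ext: "prob_extension M Mb pr" and C: "subalgebra M C"
    and V: "integrable M V"
  shows "AE w in Mb. real_cond_exp M C V (pr w) = ext_cond_exp Mb pr C (\<lambda>w. V (pr w)) w"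
proof -
  have pr[measurable]: "pr \<in> measurable Mb M" and d: "distr Mb M pr = M" and Mb: "prob_space Mb"
    using ext by (auto simp: prob_extension_def)
  interpret M: sigma_finite_subalgebra M C using M C by (rule prob_space_imp_sigma_finite_subalgebra)
  let ?F = "vimage_algebra (space Mb) pr C"
  interpret B: sigma_finite_subalgebra Mb ?F
    by (intro prob_space_imp_sigma_finite_subalgebra Mb subalgebra_vimage[OF pr C])
  have prC: "pr \<in> measurable Mb C" by (rule measurable_into_subalgebra[OF C pr])
  have int: "integrable Mb (\<lambda>w. h (pr w))" if "integrable M h" for h :: "_ \<Rightarrow> real"
    using that integrable_distr[OF pr, of h] d by simp
  have itg: "(\<integral>w. h (pr w) \<partial>Mb) = (\<integral>x. h x \<partial>M)" if "h \<in> borel_measurable M" for h :: "_ \<Rightarrow> real"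
    using integral_distr[OF pr that] d by simp
  have "AE w in Mb. real_cond_exp Mb ?F (\<lambda>w. V (pr w)) w = real_cond_exp M C V (pr w)"
  proof (rule B.real_cond_exp_charact)
    show "integrable Mb (\<lambda>w. V (pr w))" "integrable Mb (\<lambda>w. real_cond_exp M C V (pr w))"
      using V M.real_cond_exp_int(1) by (auto intro!: int)
    have "pr \<in> measurable ?F C" 
      by (intro measurable_vimage_algebra1) (use prC in \<open>auto dest: measurable_space\<close>)
    then show "(\<lambda>w. real_cond_exp M C V (pr w)) \<in> borel_measurable ?F" by measurable
    fix A assume "A \<in> sets ?F"
    then obtain A' where A: "A = pr -` A' \<inter> space Mb" and A': "A' \<in> sets C"
      using sets_vimage_algebra2[of pr "space Mb" C] prC by (auto dest: measurable_space)
    have A'M[measurable]: "A' \<in> sets M" using A' C by (auto simp: subalgebra_def)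
    have ind: "(\<integral>w\<in>A. h (pr w) \<partial>Mb) = (\<integral>x\<in>A'. h x \<partial>M)" if [measurable]: "h \<in> borel_measurable M" for h :: "_ \<Rightarrow> real"
    proof -
      have "(\<integral>w\<in>A. h (pr w) \<partial>Mb) = (\<integral>w. indicator A' (pr w) * h (pr w) \<partial>Mb)"
        unfolding set_lebesgue_integral_def by (intro Bochner_Integration.integral_cong) (auto simp: A indicator_def)
      also have "\<dots> = (\<integral>x. indicator A' x * h x \<partial>M)" by (intro itg) measurable
      finally show ?thesis by (simp add: set_lebesgue_integral_def)
    qed
    show "(\<integral>w\<in>A. V (pr w) \<partial>Mb) = (\<integral>w\<in>A. real_cond_exp M C V (pr w) \<partial>Mb)"
      using V M.real_cond_exp_intA[OF V A'] by (subst (1 2) ind) auto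
  qed
  then show ?thesis unfolding ext_cond_exp_def by auto
qed

text \<open>The positive part of the excess of \<open>X n\<close> over the limit superior tends to 0
  pointwise and is at most 1, so dominated convergence removes it.\<close>

lemma reverse_Fatou_bounded:
  fixes X :: "nat \<Rightarrow> 'w \<Rightarrow> real"
  assumes "prob_space N" and [measurable]: "\<And>n. X n \<in> borel_measurable N"
    and bd: "\<And>n. AE w in N. 0 \<le> X n w \<and> X n w \<le> 1"
    and lim: "(\<integral>w. real_of_ereal (limsup (\<lambda>n. ereal (X n w))) \<partial>N) < t"
  shows "eventually (\<lambda>n. (\<integral>w. X n w \<partial>N) < t) sequentially"
proof -
  interpret prob_space N by fact
  define L where "L w = real_of_ereal (limsup (\<lambda>n. ereal (X n w)))" for w
  have [measurable]: "L \<in> borel_measurable N" unfolding L_def by measurable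
  have bdA: "AE w in N. \<forall>n. 0 \<le> X n w \<and> X n w \<le> 1" using bd by (simp add: AE_all_countable)
  have L: "limsup (\<lambda>n. ereal (X n w)) = ereal (L w) \<and> 0 \<le> L w \<and> L w \<le> 1"
    if "\<forall>n. 0 \<le> X n w \<and> X n w \<le> 1" for w
  proof -
    have 1: "limsup (\<lambda>n. ereal (X n w)) \<le> 1" using that by (intro Limsup_bounded) auto
    have 0: "0 \<le> limsup (\<lambda>n. ereal (X n w))"
      using that by (intro le_Limsup) (auto intro: always_eventually)
    from 0 1 show ?thesis unfolding L_def by (cases "limsup (\<lambda>n. ereal (X n w))") auto
  qed
  define D where "D n w = max 0 (X n w - L w)" for n w
  have [measurable]: "D n \<in> borel_measurable N" for n unfolding D_def by measurable
  have Dlim: "(\<lambda>n. D n w) \<longlonglongrightarrow> 0" if "\<forall>n. 0 \<le> X n w \<and> X n w \<le> 1" for w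
  proof (rule tendstoI)
    fix e :: real assume "e > 0"
    then have "limsup (\<lambda>n. ereal (X n w)) < ereal (L w + e)" using L[OF that] by simp
    then have "eventually (\<lambda>n. ereal (X n w) < ereal (L w + e)) sequentially" by (rule Limsup_lessD)
    then show "eventually (\<lambda>n. dist (D n w) 0 < e) sequentially"
      by eventually_elim (use \<open>e > 0\<close> in \<open>auto simp: D_def\<close>)
  qed
  have Dbd: "norm (D n w) \<le> 1" if "\<forall>n. 0 \<le> X n w \<and> X n w \<le> 1" for n w
  proof -
    have "X n w \<le> 1" "0 \<le> L w" using that L[OF that] by auto
    then show ?thesis by (simp add: D_def)
  qed
  have IL: "integrable N L" using bdA L by (intro integrable_const_bound[where B = 1]) auto
  have ID: "integrable N (D n)" for n
  proof (intro integrable_const_bound[where B = 1])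
    show "AE w in N. norm (D n w) \<le> 1"
      using bdA by eventually_elim (rule Dbd)
  qed measurable
  have "(\<lambda>n. \<integral>w. D n w \<partial>N) \<longlonglongrightarrow> (\<integral>w. 0 \<partial>N)"
  proof (rule integral_dominated_convergence[where w = "\<lambda>_. 1"])
    show "AE w in N. (\<lambda>n. D n w) \<longlonglongrightarrow> 0" using bdA Dlim by auto
    show "AE w in N. norm (D n w) \<le> 1" for n
      using bdA by eventually_elim (rule Dbd)
  qed auto
  then have "(\<lambda>n. (\<integral>w. L w \<partial>N) + (\<integral>w. D n w \<partial>N)) \<longlonglongrightarrow> (\<integral>w. L w \<partial>N) + 0" by (intro tendsto_intros) auto
  then have "eventually (\<lambda>n. (\<integral>w. L w \<partial>N) + (\<integral>w. D n w \<partial>N) < t) sequentially"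
    using lim by (intro order_tendstoD) (auto simp: L_def)
  then show ?thesis
  proof eventually_elim
    case (elim n)
    have "(\<integral>w. X n w \<partial>N) \<le> (\<integral>w. L w + D n w \<partial>N)"
    proof (rule integral_mono_AE)
      show "integrable N (X n)" using bd[of n] by (intro integrable_const_bound[where B = 1]) auto
      show "integrable N (\<lambda>w. L w + D n w)" using IL ID by simp
    qed (auto simp: D_def)
    with elim IL ID show ?case by simp
  qed
qed

section \<open>One-sided bounds for conditional expectations\<close>

text \<open>Suppose that each tolerance admits an approximation \<open>\<phi>\<close> that nearly
  dominates \<open>v\<close> for large \<open>n\<close>, is nearly dominated by \<open>vl\<close> in
  the limit, and whose conditional expectations converge. Then the conditional expectation of
  \<open>v\<close> cannot stay above that of \<open>vl\<close>: the difference splits as \<open>(v -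
  \<phi> \<Psi>) + (\<phi> \<Psi> - \<phi>l) + (\<phi>l - vl)\<close>, each term multiplied by
  \<open>Y\<close>, and the positive part of each has small mean. It matters that \<open>Y\<close> is
  nonnegative, since otherwise the factor would turn the inequalities around.\<close>

lemma cond_exp_limsup_from_above:
  fixes v \<Psi> :: "nat \<Rightarrow> 'w \<Rightarrow> real" and vl Y :: "'w \<Rightarrow> real"
  assumes N: "prob_space N" and F: "subalgebra N F"
    and [measurable]: "\<And>n. v n \<in> borel_measurable N" "\<And>n. \<Psi> n \<in> borel_measurable N"
      "vl \<in> borel_measurable N" "Y \<in> borel_measurable N"
    and v: "\<And>n w. w \<in> space N \<Longrightarrow> v n w \<in> {0..K}" and vl: "\<And>w. w \<in> space N \<Longrightarrow> vl w \<in> {0..K}"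
    and \<Psi>: "\<And>n w. w \<in> space N \<Longrightarrow> \<Psi> n w \<in> {0..1}" and Y: "\<And>w. w \<in> space N \<Longrightarrow> Y w \<in> {0..B}"
    and \<Psi>1: "(\<lambda>n. \<integral>w. 1 - \<Psi> n w \<partial>N) \<longlonglongrightarrow> 0"
    and approx: "\<And>t. t > 0 \<Longrightarrow> \<exists>\<phi> \<phi>l. (\<forall>n. \<phi> n \<in> borel_measurable N) \<and> \<phi>l \<in> borel_measurable N \<and>
        (\<forall>w. (\<forall>n. \<phi> n w \<in> {0..K}) \<and> \<phi>l w \<in> {0..K}) \<and>
        eventually (\<lambda>n. (\<integral>w. max 0 (v n w - \<phi> n w) * \<Psi> n w \<partial>N) \<le> t) sequentially \<and>
        (\<lambda>n. \<integral>w. \<bar>real_cond_exp N F (\<lambda>w. \<phi> n w * \<Psi> n w * Y w) w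
                  - real_cond_exp N F (\<lambda>w. \<phi>l w * Y w) w\<bar> \<partial>N) \<longlonglongrightarrow> 0 \<and>
        (\<integral>w. max 0 (\<phi>l w - vl w) \<partial>N) \<le> t"
  shows "(\<lambda>n. \<integral>w. max 0 (real_cond_exp N F (\<lambda>w. v n w * Y w) w
                       - real_cond_exp N F (\<lambda>w. vl w * Y w) w) \<partial>N) \<longlonglongrightarrow> 0"
    (is "?I \<longlonglongrightarrow> 0")
proof -
  interpret prob_space N by fact
  interpret F: sigma_finite_subalgebra N F using N F by (rule prob_space_imp_sigma_finite_subalgebra)
  let ?E = "real_cond_exp N F"
  obtain w0 where "w0 \<in> space N" using not_empty by auto
  then have K: "K \<ge> 0" and B: "B \<ge> 0" using vl[of w0] Y[of w0] by auto
  have prod: "x * y \<in> {0..a * b}" if "x \<in> {0..a}" "y \<in> {0..b}" for x y a b :: real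
    using that by (auto intro: mult_mono)
  have int: "integrable N h" if "h \<in> borel_measurable N" "\<And>w. w \<in> space N \<Longrightarrow> \<bar>h w\<bar> \<le> bnd" for h :: "'w \<Rightarrow> real" and bnd
    using that by (intro integrable_const_bound[where B = bnd]) auto
  have bound: "eventually (\<lambda>n. ?I n < 2 * B * t + 2 * t) sequentially" if "t > 0" for t
  proof -
    from approx[OF that] obtain \<phi> \<phi>l where [measurable]: "\<And>n. \<phi> n \<in> borel_measurable N" "\<phi>l \<in> borel_measurable N"
      and \<phi>: "\<And>n w. \<phi> n w \<in> {0..K}" and \<phi>l: "\<And>w. \<phi>l w \<in> {0..K}"
      and a: "eventually (\<lambda>n. (\<integral>w. max 0 (v n w - \<phi> n w) * \<Psi> n w \<partial>N) \<le> t) sequentially"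
      and b: "(\<lambda>n. \<integral>w. \<bar>?E (\<lambda>w. \<phi> n w * \<Psi> n w * Y w) w - ?E (\<lambda>w. \<phi>l w * Y w) w\<bar> \<partial>N) \<longlonglongrightarrow> 0"
      and c: "(\<integral>w. max 0 (\<phi>l w - vl w) \<partial>N) \<le> t" by blast
    have b': "eventually (\<lambda>n. (\<integral>w. \<bar>?E (\<lambda>w. \<phi> n w * \<Psi> n w * Y w) w - ?E (\<lambda>w. \<phi>l w * Y w) w\<bar> \<partial>N) < t) sequentially"
      using order_tendstoD(2)[OF b that] .
    have "(\<lambda>n. B * K * (\<integral>w. 1 - \<Psi> n w \<partial>N)) \<longlonglongrightarrow> B * K * 0" by (intro tendsto_intros \<Psi>1)
    then have \<Psi>e: "eventually (\<lambda>n. B * K * (\<integral>w. 1 - \<Psi> n w \<partial>N) < t) sequentially"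
      using that by (intro order_tendstoD) auto
    from a b' \<Psi>e show ?thesis
    proof eventually_elim
      case (elim n)
      let ?V = "\<lambda>w. v n w * Y w" and ?P = "\<lambda>w. \<phi> n w * \<Psi> n w * Y w"
      let ?L = "\<lambda>w. \<phi>l w * Y w" and ?W = "\<lambda>w. vl w * Y w"
      have bd: "\<bar>?V w\<bar> \<le> K * B" "\<bar>?P w\<bar> \<le> K * 1 * B" "\<bar>?L w\<bar> \<le> K * B" "\<bar>?W w\<bar> \<le> K * B" if "w \<in> space N" for w
        using prod[OF v[OF that, of n] Y[OF that]] prod[OF prod[OF \<phi>[of n w] \<Psi>[OF that, of n]] Y[OF that]]
          prod[OF \<phi>l[of w] Y[OF that]] prod[OF vl[OF that] Y[OF that]] by auto
      have I[simp]: "integrable N ?V" "integrable N ?P" "integrable N ?L" "integrable N ?W"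
        using bd by (auto intro!: int)
      note E = F.real_cond_exp_int(1)[OF I(1)] F.real_cond_exp_int(1)[OF I(2)]
         F.real_cond_exp_int(1)[OF I(3)] F.real_cond_exp_int(1)[OF I(4)]
      let ?d1 = "?E (\<lambda>w. ?V w - ?P w)" and ?d3 = "?E (\<lambda>w. ?L w - ?W w)"
      have Id: "integrable N ?d1" "integrable N ?d3" by (auto intro!: F.real_cond_exp_int(1))
      have "?I n \<le> (\<integral>w. max 0 (?d1 w) + \<bar>?E ?P w - ?E ?L w\<bar> + max 0 (?d3 w) \<partial>N)"
      proof (rule integral_mono_AE)
        show "AE w in N. max 0 (?E ?V w - ?E ?W w) \<le> max 0 (?d1 w) + \<bar>?E ?P w - ?E ?L w\<bar> + max 0 (?d3 w)"
          using F.real_cond_exp_diff[OF I(1,2)] F.real_cond_exp_diff[OF I(3,4)]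
          by eventually_elim linarith
      qed (use E Id in auto)
      also have "\<dots> = (\<integral>w. max 0 (?d1 w) \<partial>N) + (\<integral>w. \<bar>?E ?P w - ?E ?L w\<bar> \<partial>N) + (\<integral>w. max 0 (?d3 w) \<partial>N)"
        using E Id by simp
      also have "(\<integral>w. max 0 (?d1 w) \<partial>N) \<le> B * K * (\<integral>w. 1 - \<Psi> n w \<partial>N) + B * t"
      proof -
        have i2: "integrable N (\<lambda>w. 1 - \<Psi> n w)" using \<Psi> by (intro int[of _ 1]) auto
        have m: "max 0 (v n w - \<phi> n w) \<in> {0..K}" if "w \<in> space N" for w
          using v[OF that, of n] \<phi>[of n w] by auto
        have i3: "integrable N (\<lambda>w. max 0 (v n w - \<phi> n w) * \<Psi> n w)"
          using prod[OF m \<Psi>[of _ n]] by (intro int[of _ "K * 1"]) auto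
        have "(\<integral>w. max 0 (?d1 w) \<partial>N) \<le> (\<integral>w. max 0 (?V w - ?P w) \<partial>N)"
          by (rule F.integral_pos_part_real_cond_exp_le) simp
        also have "\<dots> \<le> (\<integral>w. B * K * (1 - \<Psi> n w) + B * (max 0 (v n w - \<phi> n w) * \<Psi> n w) \<partial>N)"
        proof (rule integral_mono_AE)
          have "max 0 (?V w - ?P w) \<le> B * K * (1 - \<Psi> n w) + B * (max 0 (v n w - \<phi> n w) * \<Psi> n w)" if w: "w \<in> space N" for w
          proof -
            have p: "0 \<le> \<Psi> n w" "\<Psi> n w \<le> 1" "0 \<le> Y w" "Y w \<le> B" "0 \<le> v n w" "v n w \<le> K"
              using w \<Psi> Y v by auto
            have "v n w * (1 - \<Psi> n w) \<le> K * (1 - \<Psi> n w)" using p by (intro mult_right_mono) auto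
            moreover have "(v n w - \<phi> n w) * \<Psi> n w \<le> max 0 (v n w - \<phi> n w) * \<Psi> n w"
              using p by (intro mult_right_mono) auto
            ultimately have "v n w - \<phi> n w * \<Psi> n w \<le> K * (1 - \<Psi> n w) + max 0 (v n w - \<phi> n w) * \<Psi> n w" (is "_ \<le> ?r")
              by (simp add: algebra_simps)
            moreover have r: "0 \<le> ?r" using p K by auto
            ultimately have "(v n w - \<phi> n w * \<Psi> n w) * Y w \<le> ?r * Y w" using p by (intro mult_right_mono) auto
            also have "\<dots> \<le> ?r * B" using p r by (intro mult_left_mono) auto
            finally have "max 0 (?V w - ?P w) \<le> B * ?r" using mult_nonneg_nonneg[OF B r] by (simp add: algebra_simps)
            then show ?thesis by (simp add: algebra_simps)
          qed
          then show "AE w in N. max 0 (?V w - ?P w) \<le> B * K * (1 - \<Psi> n w) + B * (max 0 (v n w - \<phi> n w) * \<Psi> n w)" by simp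
        qed (use i2 i3 in \<open>auto intro!: Bochner_Integration.integrable_add Bochner_Integration.integrable_diff\<close>)
        also have "\<dots> = B * K * (\<integral>w. 1 - \<Psi> n w \<partial>N) + B * (\<integral>w. max 0 (v n w - \<phi> n w) * \<Psi> n w \<partial>N)"
          using i2 i3 by (subst Bochner_Integration.integral_add) (auto simp del: Bochner_Integration.integral_diff)
        also have "\<dots> \<le> B * K * (\<integral>w. 1 - \<Psi> n w \<partial>N) + B * t"
          using elim(1) B by (intro add_left_mono mult_left_mono)
        finally show ?thesis .
      qed
      also have "(\<integral>w. max 0 (?d3 w) \<partial>N) \<le> B * t"
      proof -
        have "max 0 (\<phi>l w - vl w) \<in> {0..K}" if "w \<in> space N" for w
          using vl[OF that] \<phi>l[of w] by auto
        then have i3: "integrable N (\<lambda>w. max 0 (\<phi>l w - vl w))"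
          by (intro int[of _ K]) auto
        have "(\<integral>w. max 0 (?d3 w) \<partial>N) \<le> (\<integral>w. max 0 (?L w - ?W w) \<partial>N)"
          by (rule F.integral_pos_part_real_cond_exp_le) simp
        also have "\<dots> \<le> (\<integral>w. B * max 0 (\<phi>l w - vl w) \<partial>N)"
        proof (rule integral_mono_AE)
          have "max 0 (?L w - ?W w) \<le> B * max 0 (\<phi>l w - vl w)" if w: "w \<in> space N" for w
          proof -
            have p: "0 \<le> Y w" "Y w \<le> B" using w Y by auto
            have "(\<phi>l w - vl w) * Y w \<le> max 0 (\<phi>l w - vl w) * Y w" using p by (intro mult_right_mono) auto
            also have "\<dots> \<le> max 0 (\<phi>l w - vl w) * B" using p by (intro mult_left_mono) auto
            finally show ?thesis using B by (simp add: algebra_simps)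
          qed
          then show "AE w in N. max 0 (?L w - ?W w) \<le> B * max 0 (\<phi>l w - vl w)" by simp
        qed (use i3 in auto)
        also have "\<dots> \<le> B * t" using c B by (simp add: mult_left_mono)
        finally show ?thesis .
      qed
      finally show ?case using elim by linarith
    qed
  qed
  show ?thesis
  proof (rule tendstoI)
    fix e :: real assume "e > 0"
    define t where "t = e / (2 * B + 2)"
    have "t > 0" "t * (2 * B + 2) = e" using \<open>e > 0\<close> B by (auto simp: t_def)
    then have "t > 0" "2 * B * t + 2 * t = e" by (auto simp: algebra_simps)
    moreover have "?I n \<ge> 0" for n by (intro integral_nonneg_AE) auto
    ultimately show "eventually (\<lambda>n. dist (?I n) 0 < e) sequentially" using bound[of t] by simp
  qed
qed

lemma bounded_image_Icc: "(\<And>x. x \<in> S \<Longrightarrow> f x \<in> {l..h::real}) \<Longrightarrow> bounded (f ` S)"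
  by (rule bounded_subset[of "{l..h}"]) auto

text \<open>The one-sided statement for \<open>K - f\<close> controls the negative part for
  \<open>f\<close>. The restrictions to nonnegative \<open>f\<close> and \<open>Y\<close> go away
  because adding a constant to \<open>f\<close> leaves the difference \<open>f (U n) - f Ul\<close>
  unchanged, while \<open>Y\<close> is the difference of the nonnegative functions \<open>Y +
  B\<close> and \<open>B\<close>.\<close>

lemma real_cond_exp_L1_if_one_sided:
  fixes U :: "nat \<Rightarrow> 'w \<Rightarrow> 'c::topological_space" and G :: "'a measure"
  assumes N: "prob_space N" and F: "subalgebra N F"
    and U[measurable]: "\<And>n. U n \<in> borel_measurable N" "Ul \<in> borel_measurable N" and p[measurable]: "p \<in> measurable N G"
    and one: "\<And>f Y K B. continuous_on UNIV f \<Longrightarrow> (\<And>x. f x \<in> {0..K}) \<Longrightarrow> Y \<in> borel_measurable G \<Longrightarrow>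
      (\<And>x. x \<in> space G \<Longrightarrow> Y x \<in> {0..B}) \<Longrightarrow>
      (\<lambda>n. \<integral>w. max 0 (real_cond_exp N F (\<lambda>w. f (U n w) * Y (p w)) w
                       - real_cond_exp N F (\<lambda>w. f (Ul w) * Y (p w)) w) \<partial>N) \<longlonglongrightarrow> (0::real)"
    and f: "continuous_on UNIV f" "bounded (range f)" and Y: "Y \<in> borel_measurable G" "bounded (Y ` space G)"
  shows "(\<lambda>n. \<integral>w. \<bar>real_cond_exp N F (\<lambda>w. f (U n w) * Y (p w)) w
                  - real_cond_exp N F (\<lambda>w. f (Ul w) * Y (p w)) w\<bar> \<partial>N) \<longlonglongrightarrow> (0::real)"
proof -
  interpret prob_space N by fact
  interpret F: sigma_finite_subalgebra N F using N F by (rule prob_space_imp_sigma_finite_subalgebra)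
  let ?E = "real_cond_exp N F"
  define \<Delta> where "\<Delta> f Y n w = (f (U n w) - f (Ul w)) * Y (p w)" for f :: "'c \<Rightarrow> real" and Y n w
  define good where "good f Y \<longleftrightarrow> continuous_on UNIV f \<and> bounded (range f) \<and> Y \<in> borel_measurable G \<and> bounded (Y ` space G)"
    for f :: "'c \<Rightarrow> real" and Y :: "'a \<Rightarrow> real"
  have meas: "f \<in> borel_measurable borel" "Y \<in> borel_measurable G" if "good f Y" for f Y
    using that by (auto simp: good_def borel_measurable_continuous_onI)
  have int: "integrable N (\<lambda>w. f (X w) * Y (p w))" if g: "good f Y" and [measurable]: "X \<in> borel_measurable N" for f Y X
  proof -
    note [measurable] = meas[OF g]
    obtain a b where a: "\<And>x. \<bar>f x\<bar> \<le> a" and b: "\<And>x. x \<in> space G \<Longrightarrow> \<bar>Y x\<bar> \<le> b"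
      using g by (fastforce simp: good_def bounded_iff)
    have "\<bar>f (X w) * Y (p w)\<bar> \<le> a * b" if "w \<in> space N" for w
    proof -
      have "0 \<le> a" using a[of "X w"] by linarith
      then show ?thesis unfolding abs_mult using that a b by (intro mult_mono) (auto intro: measurable_space[OF p])
    qed
    then show ?thesis by (intro integrable_const_bound[where B = "a * b"]) auto
  qed
  have \<Delta>: "integrable N (\<Delta> f Y n)"
    "AE w in N. ?E (\<lambda>w. f (U n w) * Y (p w)) w - ?E (\<lambda>w. f (Ul w) * Y (p w)) w = ?E (\<Delta> f Y n) w" if "good f Y" for f Y n
  proof -
    note i = int[OF that U(1), of n] int[OF that U(2)]
    have eq: "\<Delta> f Y n = (\<lambda>w. f (U n w) * Y (p w) - f (Ul w) * Y (p w))" by (auto simp: \<Delta>_def algebra_simps)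
    show "integrable N (\<Delta> f Y n)" unfolding eq using i by simp
    show "AE w in N. ?E (\<lambda>w. f (U n w) * Y (p w)) w - ?E (\<lambda>w. f (Ul w) * Y (p w)) w = ?E (\<Delta> f Y n) w"
      unfolding eq using F.real_cond_exp_diff[OF i] by auto
  qed
  have IE: "integrable N (?E (\<Delta> f Y n))" if "good f Y" for f Y n
    by (rule F.real_cond_exp_int(1)[OF \<Delta>(1)[OF that]])
  have pos: "(\<lambda>n. \<integral>w. max 0 (?E (\<Delta> f Y n) w) \<partial>N) \<longlonglongrightarrow> 0"
    if "continuous_on UNIV f" "\<And>x. f x \<in> {0..K}" "Y \<in> borel_measurable G" "\<And>x. x \<in> space G \<Longrightarrow> Y x \<in> {0..B}" for f Y K B
  proof -
    have "bounded (range f)" "bounded (Y ` space G)"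
      by (rule bounded_image_Icc, rule that(2)) (rule bounded_image_Icc, rule that(4))
    then have g: "good f Y" using that by (auto simp: good_def)
    have "(\<integral>w. max 0 (?E (\<Delta> f Y n) w) \<partial>N) = (\<integral>w. max 0 (?E (\<lambda>w. f (U n w) * Y (p w)) w
                       - ?E (\<lambda>w. f (Ul w) * Y (p w)) w) \<partial>N)" for n
      using \<Delta>(2)[OF g, of n] by (intro integral_cong_AE) auto
    then show ?thesis using one[OF that] by simp
  qed
  \<comment> \<open>\<open>\<bar>y\<bar> = max 0 y + max 0 (- y)\<close>, and \<open>\<Delta> (K -
    f) = - \<Delta> f\<close>.\<close>
  have abs: "(\<lambda>n. \<integral>w. \<bar>?E (\<Delta> f Y n) w\<bar> \<partial>N) \<longlonglongrightarrow> 0"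
    if f: "continuous_on UNIV f" "\<And>x. f x \<in> {0..K}" and Y: "Y \<in> borel_measurable G" "\<And>x. x \<in> space G \<Longrightarrow> Y x \<in> {0..B}" for f Y K B
  proof -
    let ?f = "\<lambda>x. K - f x"
    have f': "continuous_on UNIV ?f" "?f x \<in> {0..K}" for x
      using f(2)[of x] by (auto intro!: continuous_intros f(1))
    have "bounded (range f)" "bounded (range ?f)" "bounded (Y ` space G)"
      by (rule bounded_image_Icc, rule f(2)) (rule bounded_image_Icc, rule f'(2), rule bounded_image_Icc, rule Y(2))
    then have g: "good f Y" "good ?f Y" using f(1) Y(1) f'(1) by (auto simp: good_def)
    have "(\<integral>w. \<bar>?E (\<Delta> f Y n) w\<bar> \<partial>N) = (\<integral>w. max 0 (?E (\<Delta> f Y n) w) \<partial>N) + (\<integral>w. max 0 (?E (\<Delta> ?f Y n) w) \<partial>N)" for n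
    proof -
      have "\<Delta> ?f Y n = (\<lambda>w. -1 * \<Delta> f Y n w)" by (auto simp: \<Delta>_def algebra_simps)
      then have "AE w in N. ?E (\<Delta> ?f Y n) w = - ?E (\<Delta> f Y n) w"
        using F.real_cond_exp_cmult[OF \<Delta>(1)[OF g(1)], of "-1" n] by simp
      then have "(\<integral>w. \<bar>?E (\<Delta> f Y n) w\<bar> \<partial>N) = (\<integral>w. max 0 (?E (\<Delta> f Y n) w) + max 0 (?E (\<Delta> ?f Y n) w) \<partial>N)"
        by (intro integral_cong_AE) auto
      then show ?thesis using IE[OF g(1)] IE[OF g(2)] by simp
    qed
    then show ?thesis using tendsto_add[OF pos[OF f Y] pos[OF f' Y]] by simp
  qed
  obtain K where K: "\<And>x. \<bar>f x\<bar> \<le> K" using f(2) by (auto simp: bounded_iff)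
  obtain B0 where B0: "\<And>x. x \<in> space G \<Longrightarrow> \<bar>Y x\<bar> \<le> B0" using Y(2) by (auto simp: bounded_iff)
  define B where "B = max 0 B0"
  have B: "\<bar>Y x\<bar> \<le> B" if "x \<in> space G" for x using B0[OF that] by (simp add: B_def)
  have B_nonneg: "0 \<le> B" by (simp add: B_def)
  let ?f = "\<lambda>x. f x + K" and ?Y = "\<lambda>x. Y x + B" and ?B = "\<lambda>_::'a. B"
  have f': "continuous_on UNIV ?f" "?f x \<in> {0..2 * K}" for x
    using K[of x] by (auto intro!: continuous_intros f(1) simp: abs_le_iff)
  have Y': "?Y \<in> borel_measurable G" "\<And>x. x \<in> space G \<Longrightarrow> ?Y x \<in> {0..2 * B}"
    "?B \<in> borel_measurable G" "\<And>x. x \<in> space G \<Longrightarrow> ?B x \<in> {0..B}"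
    using Y(1) B B_nonneg by (force simp: abs_le_iff)+
  have bd: "bounded (range ?f)" "bounded (?Y ` space G)" "bounded (?B ` space G)"
    by (rule bounded_image_Icc, rule f'(2))
      (rule bounded_image_Icc, rule Y'(2), assumption, rule bounded_image_Icc, rule Y'(4), assumption)
  then have g: "good f Y" "good ?f ?Y" "good ?f ?B" using f Y f'(1) Y' by (auto simp: good_def)
  have bnd: "(\<integral>w. \<bar>?E (\<lambda>w. f (U n w) * Y (p w)) w - ?E (\<lambda>w. f (Ul w) * Y (p w)) w\<bar> \<partial>N)
     \<le> (\<integral>w. \<bar>?E (\<Delta> ?f ?Y n) w\<bar> \<partial>N) + (\<integral>w. \<bar>?E (\<Delta> ?f ?B n) w\<bar> \<partial>N)" for n
  proof -
    have "\<Delta> f Y n = (\<lambda>w. \<Delta> ?f ?Y n w - \<Delta> ?f ?B n w)" by (auto simp: \<Delta>_def algebra_simps)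
    then have *: "AE w in N. ?E (\<Delta> f Y n) w = ?E (\<Delta> ?f ?Y n) w - ?E (\<Delta> ?f ?B n) w"
      using F.real_cond_exp_diff[OF \<Delta>(1)[OF g(2)] \<Delta>(1)[OF g(3)], of n n] by simp
    have "(\<integral>w. \<bar>?E (\<lambda>w. f (U n w) * Y (p w)) w - ?E (\<lambda>w. f (Ul w) * Y (p w)) w\<bar> \<partial>N)
       \<le> (\<integral>w. \<bar>?E (\<Delta> ?f ?Y n) w\<bar> + \<bar>?E (\<Delta> ?f ?B n) w\<bar> \<partial>N)"
    proof (rule integral_mono_AE)
      show "AE w in N. \<bar>?E (\<lambda>w. f (U n w) * Y (p w)) w - ?E (\<lambda>w. f (Ul w) * Y (p w)) w\<bar> \<le> \<bar>?E (\<Delta> ?f ?Y n) w\<bar> + \<bar>?E (\<Delta> ?f ?B n) w\<bar>"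
        using * \<Delta>(2)[OF g(1), of n] by eventually_elim linarith
    qed (use IE[OF g(2), of n] IE[OF g(3), of n] F.real_cond_exp_int(1)[OF int[OF g(1) U(1), of n]]
        F.real_cond_exp_int(1)[OF int[OF g(1) U(2)]] in auto)
    then show ?thesis using IE[OF g(2), of n] IE[OF g(3), of n] by simp
  qed
  show ?thesis
  proof (rule tendsto_sandwich[OF _ _ tendsto_const])
    show "(\<lambda>n. (\<integral>w. \<bar>?E (\<Delta> ?f ?Y n) w\<bar> \<partial>N) + (\<integral>w. \<bar>?E (\<Delta> ?f ?B n) w\<bar> \<partial>N)) \<longlonglongrightarrow> 0"
      using tendsto_add[OF abs[OF f' Y'(1,2)] abs[OF f' Y'(3,4)]] by simp
  qed (use bnd in auto)
qed

section \<open>Measurability of suprema over uncountable sets\<close>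

lemma cSUP_eq_dense:
  fixes h :: "'a::metric_space \<Rightarrow> real"
  assumes "D \<noteq> {}" "D \<subseteq> S" "S \<subseteq> closure D" and h: "continuous_on S h" and bdd: "bdd_above (h ` S)"
  shows "(SUP x\<in>S. h x) = (SUP x\<in>D. h x)"
proof (rule antisym)
  show "(SUP x\<in>D. h x) \<le> (SUP x\<in>S. h x)" using assms by (intro cSUP_subset_mono) auto
  have bdd': "bdd_above (h ` D)" by (rule bdd_above_mono[OF bdd image_mono[OF assms(2)]])
  show "(SUP x\<in>S. h x) \<le> (SUP x\<in>D. h x)"
  proof (rule cSUP_least)
    fix s assume s: "s \<in> S"
    then have "s \<in> closure D" using assms(3) by auto
    then obtain d where d: "\<And>n. d n \<in> D" "d \<longlonglongrightarrow> s" by (auto simp: closure_sequential)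
    have "(\<lambda>n. h (d n)) \<longlonglongrightarrow> h s"
      using d(1) assms(2) by (intro continuous_on_tendsto_compose[OF h d(2) s]) (auto intro!: always_eventually)
    then show "h s \<le> (SUP x\<in>D. h x)"
      by (rule LIMSEQ_le_const2) (auto intro!: cSUP_upper d(1) bdd')
  qed (use assms in auto)
qed

text \<open>A continuous function has the same supremum over a countable dense subset. The tail and
  modulus events below are defined by suprema of this kind; their conditional probabilities carry
  information only because the events are measurable.\<close>

lemma borel_measurable_cSUP_continuous:
  fixes X :: "'w \<Rightarrow> 'a::euclidean_space \<Rightarrow> real"
  assumes "S \<noteq> {}" and meas: "\<And>x. x \<in> S \<Longrightarrow> (\<lambda>w. X w x) \<in> borel_measurable N"
    and cont: "\<And>w. w \<in> space N \<Longrightarrow> continuous_on S (X w)"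
    and bdd: "\<And>w. w \<in> space N \<Longrightarrow> bdd_above (X w ` S)"
  shows "(\<lambda>w. SUP x\<in>S. X w x) \<in> borel_measurable N"
proof -
  obtain D where D: "countable D" "D \<subseteq> S" "S \<subseteq> closure D" using separable by blast
  then have ne: "D \<noteq> {}" using assms(1) by auto
  have "(\<lambda>w. SUP x\<in>D. X w x) \<in> borel_measurable N"
  proof (rule borel_measurable_cSUP)
    show "bdd_above ((\<lambda>x. X w x) ` D)" if "w \<in> space N" for w
      by (rule bdd_above_mono[OF bdd[OF that] image_mono[OF D(2)]])
  qed (use D meas in auto)
  then show ?thesis
    using cSUP_eq_dense[OF ne D(2,3) cont bdd] by (simp cong: measurable_cong)
qed

lemma borel_measurable_apply_bcontfun:
  fixes X :: "'w \<Rightarrow> ('a::topological_space \<Rightarrow>\<^sub>C real)"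
  assumes "X \<in> borel_measurable N"
  shows "(\<lambda>w. apply_bcontfun (X w) u) \<in> borel_measurable N"
proof -
  have "continuous_on UNIV (\<lambda>g :: 'a \<Rightarrow>\<^sub>C real. apply_bcontfun g u)"
    unfolding continuous_on_iff by (metis dist_bounded le_less_trans)
  then show ?thesis by (rule borel_measurable_continuous_on[OF _ assms])
qed

section \<open>The penalised maximum\<close>

text \<open>The derivative of \<open>arctan \<circ> exp\<close> lies in \<open>[0, 1]\<close>. So a
  bound on the modulus of \<open>log z\<close> is one for \<open>arctan \<circ> z\<close>.\<close>

lemma abs_arctan_diff_le_ln:
  fixes s t :: real
  assumes "s > 0" "t > 0"
  shows "\<bar>arctan s - arctan t\<bar> \<le> \<bar>ln s - ln t\<bar>"
proof -
  have "norm (arctan (exp x) - arctan (exp y)) \<le> 1 * norm (x - y)" for x y :: real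
  proof (rule field_differentiable_bound[where S = UNIV and f' = "\<lambda>x. exp x / (1 + (exp x)\<^sup>2)"])
    fix z :: real
    show "((\<lambda>x. arctan (exp x)) has_field_derivative exp z / (1 + (exp z)\<^sup>2)) (at z within UNIV)"
      by (auto intro!: derivative_eq_intros simp: field_simps)
    have "0 \<le> (exp z - 1)\<^sup>2" by simp
    then have "2 * exp z \<le> 1 + (exp z)\<^sup>2" by (simp add: power2_diff)
    then have "exp z \<le> 1 + (exp z)\<^sup>2" using exp_gt_zero[of z] by linarith
    then show "norm (exp z / (1 + (exp z)\<^sup>2)) \<le> 1" by (simp add: divide_le_eq add_pos_nonneg)
  qed auto
  from this[of "ln s" "ln t"] show ?thesis using assms by simp
qed

text \<open>The values \<open>F i\<close> compete for the maximum, each charged \<open>b\<close>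
  times the amount by which \<open>x i\<close> falls short of the largest entry. The shortfall is
  measured after \<open>arctan\<close>, which is continuous, strictly increasing and bounded on the
  whole line. So the result is continuous in \<open>x\<close> everywhere, and a small change of
  \<open>log x\<close> causes a small charge, however large \<open>x\<close> is. A quotient of entries
  would be discontinuous at 0, and their plain difference can be large although \<open>log x\<close>
  hardly varies.\<close>

definition penalised_max :: "(nat \<Rightarrow> real) \<Rightarrow> real \<Rightarrow> nat \<Rightarrow> (nat \<Rightarrow> real) \<Rightarrow> real" where
  "penalised_max F b m x = Max ((\<lambda>i. F i - b * (Max ((\<lambda>j. arctan (x j)) ` {..m}) - arctan (x i))) ` {..m})"

lemma continuous_on_Max_atMost:
  fixes h :: "nat \<Rightarrow> 'a::topological_space \<Rightarrow> real"
  assumes "\<And>i. i \<le> m \<Longrightarrow> continuous_on S (h i)"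
  shows "continuous_on S (\<lambda>x. Max ((\<lambda>i. h i x) ` {..m}))"
  using assms
proof (induction m)
  case (Suc m)
  have "Max ((\<lambda>i. h i x) ` {..Suc m}) = max (h (Suc m) x) (Max ((\<lambda>i. h i x) ` {..m}))" for x
    by (simp add: atMost_Suc)
  then show ?case using Suc by (auto intro!: continuous_on_max)
qed simp

lemma continuous_on_penalised_max: "continuous_on S (penalised_max F b m)"
proof -
  have "continuous_on S (\<lambda>x. arctan (x i))" for i :: nat and S :: "(nat \<Rightarrow> real) set"
    by (intro continuous_on_arctan continuous_on_subset[OF continuous_on_product_coordinates]) auto
  then show ?thesis
    unfolding penalised_max_def[abs_def]
    by (intro continuous_on_Max_atMost continuous_on_diff continuous_on_mult continuous_on_const)
qed

text \<open>The lower bound comes from an index at which \<open>x\<close> is largest: it is not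
  charged.\<close>

lemma penalised_max_bounds:
  assumes "\<And>i. i \<le> m \<Longrightarrow> F i \<in> {0..K}" and "b \<ge> 0"
  shows "penalised_max F b m x \<in> {0..K}"
proof -
  let ?M = "Max ((\<lambda>j. arctan (x j)) ` {..m})"
  have le: "arctan (x i) \<le> ?M" if "i \<le> m" for i using that by (intro Max_ge) auto
  have "?M \<in> (\<lambda>j. arctan (x j)) ` {..m}" by (intro Max_in) auto
  then obtain i where i: "i \<le> m" "?M = arctan (x i)" unfolding image_iff by auto
  have "0 \<le> F i - b * (?M - arctan (x i))" using assms(1)[OF i(1)] i(2) by simp
  also have "\<dots> \<le> penalised_max F b m x" unfolding penalised_max_def using i(1) by (intro Max_ge) auto
  finally have "0 \<le> penalised_max F b m x" .
  moreover have "penalised_max F b m x \<le> K"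
    unfolding penalised_max_def
  proof (subst Max_le_iff; (intro ballI)?)
    fix y assume "y \<in> (\<lambda>i. F i - b * (?M - arctan (x i))) ` {..m}"
    then obtain i where "i \<le> m" "y = F i - b * (?M - arctan (x i))" by auto
    then show "y \<le> K" using assms(1)[of i] mult_nonneg_nonneg[OF assms(2), of "?M - arctan (x i)"] le[of i] by auto
  qed auto
  ultimately show ?thesis by simp
qed

text \<open>Measuring the shortfall from an upper bound \<open>s\<close> of the entries can only
  increase the charge.\<close>

lemma penalised_max_ge:
  assumes "i \<le> m" and "\<And>j. j \<le> m \<Longrightarrow> arctan (x j) \<le> s" and "b \<ge> 0"
  shows "F i - b * (s - arctan (x i)) \<le> penalised_max F b m x"
proof -
  let ?M = "Max ((\<lambda>j. arctan (x j)) ` {..m})"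
  have "?M \<le> s" using assms(2) by (subst Max_le_iff) auto
  then have "F i - b * (s - arctan (x i)) \<le> F i - b * (?M - arctan (x i))"
    using assms(3) by (intro diff_left_mono mult_left_mono) auto
  also have "\<dots> \<le> penalised_max F b m x" unfolding penalised_max_def using assms(1) by (intro Max_ge) auto
  finally show ?thesis .
qed

lemma penalised_max_le:
  assumes "\<And>i. i \<le> m \<Longrightarrow> F i - b * (s - arctan (x i)) \<le> g"
  shows "penalised_max F b m x \<le> g + b * (s - Max ((\<lambda>j. arctan (x j)) ` {..m}))"
  unfolding penalised_max_def
  by (subst Max_le_iff) (use assms in \<open>auto simp: algebra_simps\<close>)

text \<open>The form in which the finite-dimensional convergence is stated pads vectors with
  zeros.\<close>

lemma penalised_max_truncate:
  "penalised_max F b m (\<lambda>i. if i < Suc m then x i else 0) = penalised_max F b m x"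
proof -
  have "(\<lambda>j. arctan (if j < Suc m then x j else 0)) ` {..m} = (\<lambda>j. arctan (x j)) ` {..m}"
    by (rule image_cong) auto
  then show ?thesis unfolding penalised_max_def by (intro arg_cong[where f = Max] image_cong) auto
qed

text \<open>A net point near the maximiser has almost the maximal value of \<open>z\<close>, so it
  is hardly charged, while \<open>f\<close> there is close to \<open>f u\<close>. There is no such
  bound in the other direction: a point far from \<open>u\<close> may be nearly maximal as well and
  carry a larger value of \<open>f\<close>. This is why the whole argument is one-sided.\<close>

lemma penalised_max_near_argmax:
  fixes z f :: "'a::euclidean_space \<Rightarrow> real"
  assumes max: "\<And>v. z v \<le> z u" and u: "norm u \<le> r" and pos: "\<And>v. norm v < r + 1 \<Longrightarrow> z v > 0"
    and mod: "\<And>v w. norm v < r + 1 \<Longrightarrow> norm w < r + 1 \<Longrightarrow> norm (w - v) \<le> \<delta> \<Longrightarrow> \<bar>ln (z w) - ln (z v)\<bar> \<le> e"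
    and fmod: "\<And>v w. norm v \<le> r + 1 \<Longrightarrow> norm w \<le> r + 1 \<Longrightarrow> dist w v \<le> \<delta> \<Longrightarrow> dist (f w) (f v) \<le> t"
    and net: "\<exists>i\<le>m. dist (q i) u < \<delta>" and "\<delta> \<le> 1" and "b \<ge> 0"
  shows "f u \<le> penalised_max (\<lambda>i. f (q i)) b m (\<lambda>i. z (q i)) + t + b * e"
proof -
  obtain i where i: "i \<le> m" "dist (q i) u < \<delta>" using net by blast
  have "norm (q i) \<le> norm u + dist (q i) u" by (metis dist_norm norm_triangle_sub)
  then have qi: "norm (q i) < r + 1" using i(2) u \<open>\<delta> \<le> 1\<close> by linarith
  have zpos: "z u > 0" "z (q i) > 0" using pos u qi by auto
  have "\<bar>ln (z (q i)) - ln (z u)\<bar> \<le> e" using u qi i(2) by (intro mod) (auto simp: dist_norm)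
  then have "arctan (z u) - arctan (z (q i)) \<le> e"
    using abs_arctan_diff_le_ln[OF zpos] by linarith
  then have "b * (arctan (z u) - arctan (z (q i))) \<le> b * e" using \<open>b \<ge> 0\<close> by (rule mult_left_mono)
  moreover have "f (q i) - b * (arctan (z u) - arctan (z (q i))) \<le> penalised_max (\<lambda>i. f (q i)) b m (\<lambda>i. z (q i))"
    by (rule penalised_max_ge[OF i(1)]) (use max \<open>b \<ge> 0\<close> in \<open>auto simp: arctan_le_iff\<close>)
  moreover have "dist (f (q i)) (f u) \<le> t" using u qi i(2) by (intro fmod) auto
  ultimately show ?thesis by (auto simp: dist_real_def)
qed

lemma finite_net_of_dense_sequence:
  fixes q :: "nat \<Rightarrow> 'a::metric_space"
  assumes "closure (range q) = UNIV" and "compact S" and "\<delta> > 0"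
  shows "\<exists>m. \<forall>u\<in>S. \<exists>i\<le>m. dist (q i) u < \<delta>"
proof -
  have "S \<subseteq> (\<Union>i\<in>UNIV. ball (q i) \<delta>)"
  proof
    fix u
    have "u \<in> closure (range q)" using assms(1) by simp
    then show "u \<in> (\<Union>i\<in>UNIV. ball (q i) \<delta>)" using \<open>\<delta> > 0\<close> by (auto simp: closure_approachable)
  qed
  then obtain I where I: "finite I" "S \<subseteq> (\<Union>i\<in>I. ball (q i) \<delta>)"
    by (rule compactE_image[OF \<open>compact S\<close>, rotated]) auto
  have "\<exists>i\<le>Max (insert 0 I). dist (q i) u < \<delta>" if "u \<in> S" for u
  proof -
    have "u \<in> (\<Union>i\<in>I. ball (q i) \<delta>)" using I(2) that by blast
    then obtain i where "i \<in> I" "dist (q i) u < \<delta>" by auto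
    then show ?thesis using I(1) by (intro exI[of _ i] conjI Max_ge) auto
  qed
  then show ?thesis by blast
qed

section \<open>The penalised maximum of a field with a unique maximiser\<close>

text \<open>Outside a large ball \<open>z\<close> is below half of its maximum; on the compact rest
  the maximum is attained, and by uniqueness it is strictly smaller.\<close>

lemma unique_max_separated:
  fixes z :: "'a::euclidean_space \<Rightarrow> real"
  assumes z: "continuous_on UNIV z" and lim: "(z \<longlongrightarrow> 0) at_infinity"
    and u0: "z u0 > 0" and max: "\<And>v. z v \<le> z u" and uniq: "\<And>v. z v = z u \<Longrightarrow> v = u" and "\<kappa> > 0"
  shows "\<exists>\<gamma>>0. \<forall>v. dist v u \<ge> \<kappa> \<longrightarrow> arctan (z v) \<le> arctan (z u) - \<gamma>"
proof -
  have zu: "z u > 0" using u0 max[of u0] by linarith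
  have "eventually (\<lambda>v. dist (z v) 0 < z u / 2) at_infinity" using lim zu by (intro tendstoD) auto
  then obtain R where R: "\<And>v. norm v \<ge> R \<Longrightarrow> \<bar>z v\<bar> < z u / 2" by (auto simp: eventually_at_infinity)
  let ?S = "cball 0 R - ball u \<kappa>"
  have "compact ?S" by (intro compact_diff) auto
  have far: "arctan (z v) \<le> arctan (z u / 2)" if "norm v \<ge> R" for v
    using R[OF that] by (intro arctan_le_iff[THEN iffD2]) auto
  have half: "arctan (z u / 2) < arctan (z u)" using zu by (simp add: arctan_less_iff)
  show ?thesis
  proof (cases "?S = {}")
    case True
    have "arctan (z v) \<le> arctan (z u) - (arctan (z u) - arctan (z u / 2))" if "dist v u \<ge> \<kappa>" for v
    proof -
      have "v \<notin> cball 0 R" using True that by (auto simp: dist_commute)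
      then show ?thesis using far[of v] by (simp)
    qed
    then show ?thesis using half by (intro exI[of _ "arctan (z u) - arctan (z u / 2)"]) auto
  next
    case False
    obtain v0 where v0: "v0 \<in> ?S" "\<And>v. v \<in> ?S \<Longrightarrow> z v \<le> z v0"
      using continuous_attains_sup[OF \<open>compact ?S\<close> False continuous_on_subset[OF z subset_UNIV]] by blast
    have "v0 \<noteq> u" using v0(1) \<open>\<kappa> > 0\<close> by auto
    then have "z v0 < z u" using max[of v0] uniq[of v0] by fastforce
    then have lt: "arctan (z v0) < arctan (z u)" by (simp add: arctan_less_iff)
    define \<gamma> where "\<gamma> = min (arctan (z u) - arctan (z u / 2)) (arctan (z u) - arctan (z v0))"
    have "arctan (z v) \<le> arctan (z u) - \<gamma>" if "dist v u \<ge> \<kappa>" for v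
    proof (cases "norm v \<ge> R")
      case True then show ?thesis using far[of v] by (auto simp: \<gamma>_def)
    next
      case False
      then have "z v \<le> z v0" using that by (intro v0(2)) (auto simp: dist_commute)
      then have "arctan (z v) \<le> arctan (z v0)" by (simp add: arctan_le_iff)
      then show ?thesis by (auto simp: \<gamma>_def)
    qed
    moreover have "\<gamma> > 0" using half lt by (auto simp: \<gamma>_def)
    ultimately show ?thesis by blast
  qed
qed

text \<open>Near \<open>u\<close> continuity of \<open>f\<close> suffices. Away from
  \<open>u\<close> the gap in \<open>arctan \<circ> z\<close> is bounded below, so a large multiple of
  it exceeds the upper bound \<open>K\<close> of \<open>f\<close>.\<close>

lemma penalty_forces_argmax:
  fixes z :: "'a::euclidean_space \<Rightarrow> real" and f :: "'a \<Rightarrow> real"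
  assumes z: "continuous_on UNIV z" and lim: "(z \<longlongrightarrow> 0) at_infinity"
    and u0: "z u0 > 0" and max: "\<And>v. z v \<le> z u" and uniq: "\<And>v. z v = z u \<Longrightarrow> v = u"
    and f: "continuous_on UNIV f" "\<And>v. f v \<in> {0..K}" and "t > 0"
  shows "eventually (\<lambda>n. \<forall>v. f v - real n * (arctan (z u) - arctan (z v)) \<le> f u + t) sequentially"
proof -
  have "isCont f u" using f(1) by (simp add: continuous_on_eq_continuous_at)
  then obtain \<kappa> where \<kappa>: "\<kappa> > 0" "\<And>v. dist v u < \<kappa> \<Longrightarrow> dist (f v) (f u) < t"
    using \<open>t > 0\<close> unfolding continuous_at_eps_delta by metis
  obtain \<gamma> where \<gamma>: "\<gamma> > 0" "\<And>v. dist v u \<ge> \<kappa> \<Longrightarrow> arctan (z v) \<le> arctan (z u) - \<gamma>"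
    using unique_max_separated[OF z lim u0 max uniq \<kappa>(1)] by blast
  have "eventually (\<lambda>n. K / \<gamma> \<le> real n) sequentially"
    using filterlim_real_sequentially by (auto simp: filterlim_at_top)
  then show ?thesis
  proof eventually_elim
    case (elim n)
    show ?case
    proof
      fix v
      show "f v - real n * (arctan (z u) - arctan (z v)) \<le> f u + t"
      proof (cases "dist v u < \<kappa>")
        case True
        have "0 \<le> real n * (arctan (z u) - arctan (z v))" using max[of v] by (simp add: arctan_le_iff)
        moreover have "f v \<le> f u + t" using \<kappa>(2)[OF True] by (auto simp: dist_real_def)
        ultimately show ?thesis by linarith
      next
        case False
        have "K \<le> real n * \<gamma>" using elim \<gamma>(1) by (simp add: divide_le_eq)
        also have "\<dots> \<le> real n * (arctan (z u) - arctan (z v))"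
          using \<gamma>(2)[of v] False by (intro mult_left_mono) auto
        finally show ?thesis using f(2)[of v] f(2)[of u] \<open>t > 0\<close> by auto
      qed
    qed
  qed
qed

lemma dense_sequence_exists: "\<exists>q :: nat \<Rightarrow> 'a::second_countable_topology. closure (range q) = UNIV"
proof -
  obtain D :: "'a set" where D: "countable D" "\<And>X. open X \<Longrightarrow> X \<noteq> {} \<Longrightarrow> \<exists>d\<in>D. d \<in> X"
    using countable_dense_exists by blast
  have "closure D = UNIV"
  proof (rule ccontr)
    assume "closure D \<noteq> UNIV"
    then obtain d where "d \<in> D" "d \<in> - closure D" using D(2)[of "- closure D"] by auto
    then show False using closure_subset by blast
  qed
  moreover have "D \<noteq> {}" using D(2)[of UNIV] by auto
  ultimately have "closure (range (from_nat_into D)) = UNIV" using D(1) by (simp add: range_from_nat_into)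
  then show ?thesis by blast
qed

text \<open>The penalty \<open>n\<close> must be fixed before the number \<open>m\<close> of points:
  the error from using only \<open>m\<close> points is \<open>n\<close> times the distance of
  \<open>max\<^sub>i\<^sub>\<le>\<^sub>m x(q\<^sub>i)\<close> from the supremum, and this tends to 0
  as \<open>m\<close> grows only for fixed \<open>n\<close>. Both limits are dominated convergence,
  with countable suprema \<open>S\<close> and \<open>G n\<close> in place of suprema over the whole
  space, so that measurability is immediate.\<close>

lemma penalised_max_limit:
  fixes z :: "'w \<Rightarrow> 'a::euclidean_space \<Rightarrow> real" and q :: "nat \<Rightarrow> 'a" and ul :: "'w \<Rightarrow> 'a"
  assumes "prob_space N" and z[measurable]: "\<And>u. (\<lambda>w. z w u) \<in> borel_measurable N"
    and [measurable]: "ul \<in> borel_measurable N"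
    and path: "AE w in N. continuous_on UNIV (z w) \<and> (z w \<longlongrightarrow> 0) at_infinity \<and> z w 0 > 0 \<and>
       (\<forall>v. z w v \<le> z w (ul w)) \<and> (\<forall>v. z w v = z w (ul w) \<longrightarrow> v = ul w)"
    and q: "closure (range q) = UNIV"
    and f: "continuous_on UNIV f" "\<And>v. f v \<in> {0..K}" and "t > 0"
  shows "\<exists>n. eventually (\<lambda>m. (\<integral>w. max 0 (penalised_max (\<lambda>i. f (q i)) (real n) m (\<lambda>i. z w (q i)) - f (ul w)) \<partial>N) \<le> t)
           sequentially"
proof -
  interpret prob_space N by fact
  have [measurable]: "f \<in> borel_measurable borel" by (rule borel_measurable_continuous_onI[OF f(1)])
  define x where "x w i = arctan (z w (q i))" for w i
  have [measurable]: "(\<lambda>w. x w i) \<in> borel_measurable N" for i unfolding x_def by measurable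
  have bx: "\<bar>x w i\<bar> \<le> pi / 2" for w i
    using arctan_bounded[of "z w (q i)"] by (auto simp: x_def abs_le_iff)
  have bdd: "bdd_above (range (x w))" for w
    by (rule bdd_aboveI2[of _ _ "pi / 2"]) (rule order_trans[OF abs_ge_self bx])
  define S where "S w = (SUP i. x w i)" for w
  have [measurable]: "S \<in> borel_measurable N" unfolding S_def using bdd by (intro borel_measurable_cSUP) auto
  have xS: "x w i \<le> S w" for w i unfolding S_def by (rule cSUP_upper[OF _ bdd]) simp
  have Sb: "\<bar>S w\<bar> \<le> pi / 2" for w
  proof -
    have "S w \<le> pi / 2" unfolding S_def by (rule cSUP_least, simp) (rule order_trans[OF abs_ge_self bx])
    then show ?thesis using xS[of w 0] bx[of w 0] by (auto simp: abs_le_iff)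
  qed
  \<comment> \<open>\<open>G n\<close> is the penalised maximum over all points, which dominates the
    one over finitely many up to \<open>n * (S - R m)\<close>.\<close>
  define G where "G n w = (SUP i. f (q i) - real n * (S w - x w i))" for n w
  have Gle: "f (q i) - real n * (S w - x w i) \<le> K" for n w i
  proof -
    have "0 \<le> real n * (S w - x w i)" using xS[of w i] by (intro mult_nonneg_nonneg) auto
    then show ?thesis using f(2)[of "q i"] by auto
  qed
  have Gbdd: "bdd_above (range (\<lambda>i. f (q i) - real n * (S w - x w i)))" for n w
    using Gle by (intro bdd_aboveI2[of _ _ K]) auto
  have [measurable]: "G n \<in> borel_measurable N" for n unfolding G_def using Gbdd by (intro borel_measurable_cSUP) auto
  have GK: "G n w \<le> K" for n w unfolding G_def using Gle by (intro cSUP_least) auto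
  have max_0: "max 0 a \<le> max 0 b + d" if "a \<le> b + d" "0 \<le> d" for a b d :: real
    using that by (simp add: max_def)
  have K: "K \<ge> 0" using f(2)[of 0] by auto
  have dG: "norm (max 0 (G n w - f (ul w))) \<le> K" for n w using GK[of n w] f(2)[of "ul w"] K by auto
  have "(\<lambda>n. \<integral>w. max 0 (G n w - f (ul w)) \<partial>N) \<longlonglongrightarrow> (\<integral>w. 0 \<partial>N)"
  proof (rule integral_dominated_convergence[where w = "\<lambda>_. K"])
    show "AE w in N. (\<lambda>n. max 0 (G n w - f (ul w))) \<longlonglongrightarrow> 0"
      using path
    proof eventually_elim
      case (elim w)
      let ?g = "\<lambda>v. arctan (z w v)"
      have c: "continuous_on UNIV ?g" using elim by (intro continuous_on_arctan) auto
      have le: "?g v \<le> ?g (ul w)" for v using elim by (simp add: arctan_le_iff)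
      have "(SUP v. ?g v) = (SUP v\<in>range q. ?g v)"
        using q by (intro cSUP_eq_dense c bdd_aboveI2[of _ _ "?g (ul w)"] le) auto
      moreover have "(SUP v. ?g v) = ?g (ul w)"
        using le by (intro cSup_eq_maximum) auto
      ultimately have Sw: "S w = ?g (ul w)" by (simp add: S_def x_def image_comp)
      show ?case
      proof (rule tendstoI)
        fix e :: real assume "e > 0"
        then have "e / 2 > 0" by simp
        have "eventually (\<lambda>n. \<forall>v. f v - real n * (?g (ul w) - ?g v) \<le> f (ul w) + e / 2) sequentially"
          using elim by (intro penalty_forces_argmax[OF _ _ _ _ _ f \<open>e / 2 > 0\<close>]) auto
        then show "eventually (\<lambda>n. dist (max 0 (G n w - f (ul w))) 0 < e) sequentially"
        proof eventually_elim
          case (elim n)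
          then have "G n w \<le> f (ul w) + e / 2" unfolding G_def Sw x_def by (intro cSUP_least) auto
          then show ?case using \<open>e > 0\<close> by auto
        qed
      qed
    qed
  qed (use dG in auto)
  then have "eventually (\<lambda>n. (\<integral>w. max 0 (G n w - f (ul w)) \<partial>N) < t / 2) sequentially"
    using \<open>t > 0\<close> by (intro order_tendstoD(2)[of _ 0]) auto
  then obtain n where n: "(\<integral>w. max 0 (G n w - f (ul w)) \<partial>N) < t / 2"
    by (auto simp: eventually_sequentially)
  define R where "R m w = Max (x w ` {..m})" for m w
  have [measurable]: "R m \<in> borel_measurable N" for m
    unfolding R_def by (intro borel_measurable_Max) auto
  have RS: "R m w \<le> S w" for m w unfolding R_def using xS by (subst Max_le_iff) auto
  have xR: "i \<le> m \<Longrightarrow> x w i \<le> R m w" for i m w unfolding R_def by (intro Max_ge) auto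
  have Rb: "norm (S w - R m w) \<le> pi" for m w
    using RS[of m w] xR[of 0 m w] bx[of w 0] Sb[of w] by (auto simp: abs_le_iff)
  have Rlim: "(\<lambda>m. S w - R m w) \<longlonglongrightarrow> 0" for w
  proof (rule tendstoI)
    fix e :: real assume "e > 0"
    then obtain k where "S w - e < x w k" using less_cSUP_iff[OF _ bdd, of "S w - e" w] by (auto simp: S_def)
    then have "dist (S w - R m w) 0 < e" if "m \<ge> k" for m
      using xR[OF that, of w] RS[of m w] by auto
    then show "eventually (\<lambda>m. dist (S w - R m w) 0 < e) sequentially" by (auto simp: eventually_sequentially)
  qed
  have "(\<lambda>m. \<integral>w. S w - R m w \<partial>N) \<longlonglongrightarrow> (\<integral>w. 0 \<partial>N)"
    by (rule integral_dominated_convergence[where w = "\<lambda>_. pi"]) (use Rlim Rb in auto)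
  then have "(\<lambda>m. real n * (\<integral>w. S w - R m w \<partial>N)) \<longlonglongrightarrow> real n * 0" by (intro tendsto_intros) simp
  then have "eventually (\<lambda>m. real n * (\<integral>w. S w - R m w \<partial>N) < t / 2) sequentially"
    using \<open>t > 0\<close> by (intro order_tendstoD(2)[of _ "real n * 0"]) auto
  then have "eventually (\<lambda>m. (\<integral>w. max 0 (penalised_max (\<lambda>i. f (q i)) (real n) m (\<lambda>i. z w (q i)) - f (ul w)) \<partial>N) \<le> t) sequentially"
  proof eventually_elim
    case (elim m)
    let ?p = "\<lambda>w. penalised_max (\<lambda>i. f (q i)) (real n) m (\<lambda>i. z w (q i))"
    have [measurable]: "?p \<in> borel_measurable N" unfolding penalised_max_def by measurable
    have iG: "integrable N (\<lambda>w. max 0 (G n w - f (ul w)))"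
      using dG by (intro integrable_const_bound[where B = K]) auto
    have iR: "integrable N (\<lambda>w. S w - R m w)"
      using Rb by (intro integrable_const_bound[where B = pi]) auto
    have "norm (max 0 (?p w - f (ul w))) \<le> K" for w
    proof -
      have "?p w \<in> {0..K}" by (rule penalised_max_bounds) (use f in auto)
      then show ?thesis using f(2)[of "ul w"] K by auto
    qed
    then have ip: "integrable N (\<lambda>w. max 0 (?p w - f (ul w)))"
      by (intro integrable_const_bound[where B = K]) auto
    have "?p w \<le> G n w + real n * (S w - R m w)" for w
      unfolding R_def x_def
      by (rule penalised_max_le) (use Gbdd in \<open>auto simp: G_def x_def intro!: cSUP_upper\<close>)
    then have "?p w - f (ul w) \<le> (G n w - f (ul w)) + real n * (S w - R m w)" "0 \<le> real n * (S w - R m w)" for w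
      using RS[of m w] by (simp_all add: algebra_simps mult_left_mono)
    then have "max 0 (?p w - f (ul w)) \<le> max 0 (G n w - f (ul w)) + real n * (S w - R m w)" for w
      by (rule max_0)
    then have "(\<integral>w. max 0 (?p w - f (ul w)) \<partial>N) \<le> (\<integral>w. max 0 (G n w - f (ul w)) + real n * (S w - R m w) \<partial>N)"
      using ip iG iR by (intro integral_mono) auto
    also have "\<dots> = (\<integral>w. max 0 (G n w - f (ul w)) \<partial>N) + real n * (\<integral>w. S w - R m w \<partial>N)"
      using iG iR by (subst Bochner_Integration.integral_add) (auto simp del: Bochner_Integration.integral_diff)
    finally show ?case using elim n by linarith
  qed
  then show ?thesis by blast
qed

section \<open>Paths of the rescaled random field\<close>

lemma matrix_inv_mult:
  fixes A :: "real ^ 'n ^ 'n"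
  assumes "invertible A"
  shows "A *v (matrix_inv A *v x) = x" "matrix_inv A *v (A *v x) = x"
proof -
  have "A ** matrix_inv A = mat 1 \<and> matrix_inv A ** A = mat 1"
    unfolding matrix_inv_def using assms unfolding invertible_def by (rule someI_ex)
  then show "A *v (matrix_inv A *v x) = x" "matrix_inv A *v (A *v x) = x"
    by (simp_all add: matrix_vector_mul_assoc)
qed

lemma continuous_on_theta_dagger: "continuous_on S (theta_dagger \<theta>s A)"
  unfolding theta_dagger_def[abs_def] by (intro continuous_intros)

lemma open_U_set: "open \<Theta> \<Longrightarrow> open (U_set \<Theta> \<theta>s A)"
  using open_vimage[OF _ continuous_on_theta_dagger[of UNIV \<theta>s A], of \<Theta>] by (simp add: U_set_def vimage_def)

lemma zero_in_U_set: "\<theta>s \<in> \<Theta> \<Longrightarrow> 0 \<in> U_set \<Theta> \<theta>s A"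
  by (simp add: U_set_def theta_dagger_def)

text \<open>The affine map \<open>theta_dagger\<close> is a homeomorphism, so closures
  correspond.\<close>

lemma closure_U_set:
  assumes "invertible A"
  shows "closure (U_set \<Theta> \<theta>s A) = {u. theta_dagger \<theta>s A u \<in> closure \<Theta>}" (is "closure ?U = ?V")
proof
  have "closed ?V"
    using closed_vimage[OF closed_closure[of \<Theta>] continuous_on_theta_dagger[of UNIV \<theta>s A]] by (simp add: vimage_def)
  then show "closure ?U \<subseteq> ?V" using closure_subset[of \<Theta>] by (intro closure_minimal) (auto simp: U_set_def)
  show "?V \<subseteq> closure ?U"
  proof
    fix v assume "v \<in> ?V"
    then obtain \<theta> where \<theta>: "\<And>n. \<theta> n \<in> \<Theta>" "\<theta> \<longlonglongrightarrow> theta_dagger \<theta>s A v" by (auto simp: closure_sequential)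
    define x where "x n = matrix_inv A *v (\<theta> n - \<theta>s)" for n
    have "theta_dagger \<theta>s A (x n) = \<theta> n" for n
      by (simp add: x_def theta_dagger_def matrix_inv_mult(1)[OF assms])
    then have "x n \<in> ?U" for n using \<theta>(1) by (simp add: U_set_def)
    moreover have "x \<longlonglongrightarrow> matrix_inv A *v (theta_dagger \<theta>s A v - \<theta>s)"
      unfolding x_def using \<theta>(2)
      by (intro bounded_linear.tendsto[OF matrix_vector_mul_bounded_linear] tendsto_intros)
    ultimately show "v \<in> closure ?U"
      by (auto simp: closure_sequential theta_dagger_def matrix_inv_mult(2)[OF assms])
  qed
qed

text \<open>A small matrix maps a fixed ball into any given neighbourhood of the origin.\<close>

lemma ball_subset_U_set:
  fixes a :: "'i \<Rightarrow> real ^ 'n ^ 'n"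
  assumes a: "(a \<longlongrightarrow> 0) F" and "open \<Theta>" "\<theta>s \<in> \<Theta>"
  shows "eventually (\<lambda>T. ball 0 c \<subseteq> U_set \<Theta> \<theta>s (a T)) F"
proof -
  obtain e where e: "e > 0" "ball \<theta>s e \<subseteq> \<Theta>" using assms(2,3) by (auto simp: open_contains_ball)
  have "((\<lambda>T. (\<Sum>i\<in>UNIV. \<Sum>j\<in>UNIV. \<bar>a T $ i $ j\<bar>) * \<bar>c\<bar>) \<longlongrightarrow> (\<Sum>i\<in>UNIV. \<Sum>j\<in>UNIV. \<bar>(0 :: real ^ 'n ^ 'n) $ i $ j\<bar>) * \<bar>c\<bar>) F"
    by (intro tendsto_mult tendsto_sum tendsto_rabs tendsto_vec_nth tendsto_const a)
  then have "eventually (\<lambda>T. (\<Sum>i\<in>UNIV. \<Sum>j\<in>UNIV. \<bar>a T $ i $ j\<bar>) * \<bar>c\<bar> < e) F"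
    using e(1) by (intro order_tendstoD(2)) auto
  then show ?thesis
  proof eventually_elim
    case (elim T)
    show ?case
    proof
      fix u :: "real ^ 'n" assume u: "u \<in> ball 0 c"
      have "norm (a T *v u) \<le> onorm ((*v) (a T)) * norm u" by (rule onorm) simp
      also have "\<dots> \<le> (\<Sum>i\<in>UNIV. \<Sum>j\<in>UNIV. \<bar>a T $ i $ j\<bar>) * \<bar>c\<bar>"
        using u by (intro mult_mono onorm_le_matrix_component_sum) (auto intro!: sum_nonneg)
      finally have "norm (a T *v u) < e" using elim by linarith
      then have "theta_dagger \<theta>s (a T) u \<in> ball \<theta>s e" by (simp add: theta_dagger_def dist_norm)
      then show "u \<in> U_set \<Theta> \<theta>s (a T)" using e(2) by (auto simp: U_set_def)
    qed
  qed
qed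

text \<open>The requirements that \<open>Z_extension\<close> puts on a single path \<open>z\<close>,
  with \<open>h\<close> the corresponding path of \<open>H\<close>.\<close>

definition path_extension ::
    "(real ^ 'p) set \<Rightarrow> real ^ 'p \<Rightarrow> real ^ 'p ^ 'p \<Rightarrow> (real ^ 'p \<Rightarrow> real) \<Rightarrow> (real ^ 'p \<Rightarrow> real) \<Rightarrow> bool" where
  "path_extension \<Theta> \<theta>s A h z \<longleftrightarrow>
     (\<forall>u\<in>U_set \<Theta> \<theta>s A. z u = exp (h (theta_dagger \<theta>s A u) - h \<theta>s)) \<and>
     (\<forall>u. 0 \<le> z u) \<and> continuous_on UNIV z \<and> compact (closure {u. z u \<noteq> 0}) \<and>
     (SUP u\<in>- U_set \<Theta> \<theta>s A. z u) \<le> (SUP u\<in>frontier (U_set \<Theta> \<theta>s A). z u)"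

lemma path_extension_bdd_above:
  assumes "path_extension \<Theta> \<theta>s A h z"
  shows "bdd_above (z ` S)"
proof -
  have c: "compact (closure {u. z u \<noteq> 0})" "continuous_on UNIV z" using assms by (auto simp: path_extension_def)
  have "compact (z ` closure {u. z u \<noteq> 0})"
    by (intro compact_continuous_image continuous_on_subset[OF c(2)] c(1)) auto
  then have "bounded (insert 0 (z ` closure {u. z u \<noteq> 0}))" by (simp add: compact_imp_bounded)
  moreover have "z u \<in> insert 0 (z ` closure {u. z u \<noteq> 0})" for u
    using closure_subset[of "{u. z u \<noteq> 0}"] by auto
  ultimately have "bounded (z ` S)" by (elim bounded_subset) blast
  then show ?thesis by (rule bounded_imp_bdd_above)
qed

lemma path_extension_at_zero:
  "path_extension \<Theta> \<theta>s A h z \<Longrightarrow> \<theta>s \<in> \<Theta> \<Longrightarrow> z 0 = 1"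
  using zero_in_U_set[of \<theta>s \<Theta> A] by (auto simp: path_extension_def theta_dagger_def)

text \<open>The estimator may lie on the boundary of \<open>\<Theta>\<close>, where the formula for
  \<open>z\<close> is not assumed; it persists there by continuity.\<close>

lemma path_extension_on_closure:
  assumes p: "path_extension \<Theta> \<theta>s A h z" and h: "continuous_on (closure \<Theta>) h" and A: "invertible A"
    and u: "u \<in> closure (U_set \<Theta> \<theta>s A)"
  shows "z u = exp (h (theta_dagger \<theta>s A u) - h \<theta>s)"
proof -
  let ?U = "U_set \<Theta> \<theta>s A"
  have "continuous_on (closure ?U) (\<lambda>u. h (theta_dagger \<theta>s A u))"
    by (rule continuous_on_compose2[OF h continuous_on_theta_dagger]) (auto simp: closure_U_set[OF A])
  then have "continuous_on (closure ?U) (\<lambda>u. z u - exp (h (theta_dagger \<theta>s A u) - h \<theta>s))"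
    using p by (intro continuous_intros) (auto simp: path_extension_def intro: continuous_on_subset)
  from continuous_constant_on_closure[OF this _ u, of 0] show ?thesis
    using p by (auto simp: path_extension_def)
qed

text \<open>On the closure of \<open>U_set\<close> the field is an increasing function of the
  objective, so the rescaled estimator maximises it there. Outside, the extension is bounded by its
  values on the boundary.\<close>

lemma path_extension_maximum:
  assumes p: "path_extension \<Theta> \<theta>s A h z" and h: "continuous_on (closure \<Theta>) h" and A: "invertible A"
    and \<theta>s: "\<theta>s \<in> \<Theta>" and max: "is_arg_max h (\<lambda>\<theta>. \<theta> \<in> closure \<Theta>) \<theta>h"
  shows "matrix_inv A *v (\<theta>h - \<theta>s) \<in> closure (U_set \<Theta> \<theta>s A)" (is "?u \<in> closure ?U")
    and "z v \<le> z (matrix_inv A *v (\<theta>h - \<theta>s))"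
proof -
  have d: "theta_dagger \<theta>s A ?u = \<theta>h" by (simp add: theta_dagger_def matrix_inv_mult(1)[OF A])
  have \<theta>h: "\<theta>h \<in> closure \<Theta>" and m: "\<And>\<theta>. \<theta> \<in> closure \<Theta> \<Longrightarrow> h \<theta> \<le> h \<theta>h"
    using max by (auto simp: is_arg_max_linorder)
  show u: "?u \<in> closure ?U" using \<theta>h by (simp add: closure_U_set[OF A] d)
  have zu: "z ?u = exp (h \<theta>h - h \<theta>s)" using path_extension_on_closure[OF p h A u] by (simp add: d)
  have cl: "z v \<le> z ?u" if "v \<in> closure ?U" for v
    using path_extension_on_closure[OF p h A that] zu m that by (simp add: closure_U_set[OF A])
  show "z v \<le> z ?u"
  proof (cases "v \<in> ?U")
    case True then show ?thesis using cl closure_subset by blast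
  next
    case False
    have "?U \<noteq> {}" using zero_in_U_set[OF \<theta>s, of A] by blast
    then have "frontier ?U \<noteq> {}" using False by (intro frontier_not_empty) auto
    then have "(SUP u\<in>frontier ?U. z u) \<le> z ?u"
      by (intro cSUP_least cl) (auto simp: frontier_def)
    moreover have "z v \<le> (SUP u\<in>- ?U. z u)"
      using False by (intro cSUP_upper path_extension_bdd_above[OF p]) auto
    moreover have "(SUP u\<in>- ?U. z u) \<le> (SUP u\<in>frontier ?U. z u)" using p by (simp add: path_extension_def)
    ultimately show ?thesis by linarith
  qed
qed

text \<open>The maximum of \<open>z\<close> is at least \<open>z 0 = 1\<close>. A maximiser of norm
  above \<open>r\<close> is a limit of points of \<open>V_set\<close>, where \<open>z\<close> stays
  below \<open>e \<le> 1\<close>.\<close>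

lemma localised_maximum:
  assumes p: "path_extension \<Theta> \<theta>s A h z" and \<theta>s: "\<theta>s \<in> \<Theta>"
    and u: "u \<in> closure (U_set \<Theta> \<theta>s A)" and max: "\<And>v. z v \<le> z u"
    and tail: "sup0 (V_set \<Theta> \<theta>s A r) z < e" and "e \<le> 1"
  shows "norm u \<le> r"
proof (rule ccontr)
  assume "\<not> norm u \<le> r"
  obtain x where x: "\<And>n. x n \<in> U_set \<Theta> \<theta>s A" "x \<longlonglongrightarrow> u" using u by (auto simp: closure_sequential)
  have "(\<lambda>n. norm (x n)) \<longlonglongrightarrow> norm u" by (intro tendsto_norm x)
  then have "eventually (\<lambda>n. norm (x n) > r) sequentially"
    using \<open>\<not> norm u \<le> r\<close> by (intro order_tendstoD) auto
  then have "eventually (\<lambda>n. z (x n) \<le> sup0 (V_set \<Theta> \<theta>s A r) z) sequentially"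
  proof eventually_elim
    case (elim n)
    then have "x n \<in> V_set \<Theta> \<theta>s A r" using x(1) by (auto simp: V_set_def)
    then show ?case by (auto simp: sup0_def intro!: cSUP_upper path_extension_bdd_above[OF p])
  qed
  moreover have "(\<lambda>n. z (x n)) \<longlonglongrightarrow> z u"
    using p by (intro continuous_on_tendsto_compose[OF _ x(2)]) (auto simp: path_extension_def)
  ultimately have "z u \<le> sup0 (V_set \<Theta> \<theta>s A r) z" by (intro tendsto_upperbound) auto
  then show False using tail \<open>e \<le> 1\<close> max[of 0] path_extension_at_zero[OF p \<theta>s] by linarith
qed

text \<open>The continuous objective is bounded on the compact closure of \<open>\<Theta>\<close>.
  Without boundedness the real supremum in \<open>w_modulus\<close> would bound nothing.\<close>

lemma log_increment_bdd:
  assumes p: "path_extension \<Theta> \<theta>s A h z" and h: "continuous_on (closure \<Theta>) h" and b: "bounded \<Theta>"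
    and S: "S \<subseteq> U_set \<Theta> \<theta>s A \<times> U_set \<Theta> \<theta>s A"
  shows "bdd_above ((\<lambda>(u1, u2). \<bar>ln (z u2) - ln (z u1)\<bar>) ` S)"
proof -
  have "bounded (h ` closure \<Theta>)"
    using h b by (intro compact_imp_bounded compact_continuous_image) (auto simp: compact_closure)
  then obtain K where K: "\<And>\<theta>. \<theta> \<in> closure \<Theta> \<Longrightarrow> \<bar>h \<theta>\<bar> \<le> K" by (auto simp: bounded_iff)
  have "\<bar>ln (z u2) - ln (z u1)\<bar> \<le> 2 * K" if "(u1, u2) \<in> S" for u1 u2
  proof -
    have u: "u1 \<in> U_set \<Theta> \<theta>s A" "u2 \<in> U_set \<Theta> \<theta>s A" using that S by auto
    then have "\<bar>h (theta_dagger \<theta>s A u1)\<bar> \<le> K" "\<bar>h (theta_dagger \<theta>s A u2)\<bar> \<le> K"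
      using closure_subset[of \<Theta>] by (auto intro!: K simp: U_set_def)
    moreover have "ln (z v) = h (theta_dagger \<theta>s A v) - h \<theta>s" if "v \<in> U_set \<Theta> \<theta>s A" for v
      using p that by (simp add: path_extension_def)
    ultimately show ?thesis using u by auto
  qed
  then show ?thesis by (intro bdd_aboveI2[of _ _ "2 * K"]) auto
qed

lemma log_increment_le_w_modulus:
  assumes p: "path_extension \<Theta> \<theta>s A h z" and h: "continuous_on (closure \<Theta>) h" and b: "bounded \<Theta>"
    and u: "u1 \<in> B_set \<Theta> \<theta>s A c" "u2 \<in> B_set \<Theta> \<theta>s A c" "norm (u2 - u1) \<le> \<delta>"
  shows "\<bar>ln (z u2) - ln (z u1)\<bar> \<le> w_modulus \<Theta> \<theta>s A z \<delta> c"
proof -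
  let ?S = "{(u1, u2). u1 \<in> B_set \<Theta> \<theta>s A c \<and> u2 \<in> B_set \<Theta> \<theta>s A c \<and> norm (u2 - u1) \<le> \<delta>}"
  have "bdd_above ((\<lambda>(u1, u2). \<bar>ln (z u2) - ln (z u1)\<bar>) ` ?S)"
    by (rule log_increment_bdd[OF p h b]) (auto simp: B_set_def U_set_def)
  then have "(\<lambda>(u1, u2). \<bar>ln (z u2) - ln (z u1)\<bar>) (u1, u2) \<le> (SUP x\<in>?S. (\<lambda>(u1, u2). \<bar>ln (z u2) - ln (z u1)\<bar>) x)"
    by (intro cSUP_upper) (use u in auto)
  then show ?thesis by (simp add: w_modulus_def)
qed

lemma Z_extension_iff:
  "Z_extension M \<Theta> \<theta>s A H Z \<longleftrightarrow>
     (\<lambda>(\<omega>, u). Z \<omega> u) \<in> borel_measurable (M \<Otimes>\<^sub>M borel) \<and> (\<forall>\<omega>\<in>space M. path_extension \<Theta> \<theta>s A (H \<omega>) (Z \<omega>))"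
  by (simp add: Z_extension_def path_extension_def)

lemma Z_extension_measurable_section:
  assumes "Z_extension M \<Theta> \<theta>s A H Z"
  shows "(\<lambda>\<omega>. Z \<omega> u) \<in> borel_measurable M"
proof -
  have m: "(\<lambda>(\<omega>, u). Z \<omega> u) \<in> borel_measurable (M \<Otimes>\<^sub>M borel)" using assms by (simp add: Z_extension_iff)
  have "(\<lambda>\<omega>. (\<omega>, u)) \<in> measurable M (M \<Otimes>\<^sub>M borel)" by measurable
  from measurable_compose[OF this m] show ?thesis by simp
qed

lemma S_event_sets:
  assumes Z: "Z_extension M \<Theta> \<theta>s A H Z"
  shows "S_event M \<Theta> \<theta>s A Z r e \<in> sets M"
proof -
  have "(\<lambda>\<omega>. sup0 (V_set \<Theta> \<theta>s A r) (Z \<omega>)) \<in> borel_measurable M"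
  proof (cases "V_set \<Theta> \<theta>s A r = {}")
    case False
    have "(\<lambda>\<omega>. SUP u\<in>V_set \<Theta> \<theta>s A r. Z \<omega> u) \<in> borel_measurable M"
    proof (rule borel_measurable_cSUP_continuous[OF False])
      fix \<omega> assume "\<omega> \<in> space M"
      then have p: "path_extension \<Theta> \<theta>s A (H \<omega>) (Z \<omega>)" using Z by (simp add: Z_extension_iff)
      then show "continuous_on (V_set \<Theta> \<theta>s A r) (Z \<omega>)"
        by (auto simp: path_extension_def intro: continuous_on_subset)
      show "bdd_above (Z \<omega> ` V_set \<Theta> \<theta>s A r)" by (rule path_extension_bdd_above[OF p])
    qed (rule Z_extension_measurable_section[OF Z])
    then show ?thesis using False by (simp add: sup0_def)
  qed (simp add: sup0_def)
  then show ?thesis unfolding S_event_def by measurable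
qed

lemma W_event_sets:
  assumes Z: "Z_extension M \<Theta> \<theta>s A H Z" and H: "\<And>\<omega>. \<omega> \<in> space M \<Longrightarrow> continuous_on (closure \<Theta>) (H \<omega>)"
    and b: "bounded \<Theta>" and \<theta>s: "\<theta>s \<in> \<Theta>" and "\<delta> > 0" "c > 0"
  shows "W_event M \<Theta> \<theta>s A Z \<delta> c e \<in> sets M"
proof -
  let ?S = "{(u1, u2). u1 \<in> B_set \<Theta> \<theta>s A c \<and> u2 \<in> B_set \<Theta> \<theta>s A c \<and> norm (u2 - u1) \<le> \<delta>}"
  have sub: "?S \<subseteq> U_set \<Theta> \<theta>s A \<times> U_set \<Theta> \<theta>s A" by (auto simp: B_set_def U_set_def)
  have "(0, 0) \<in> ?S" using assms zero_in_U_set[OF \<theta>s, of A] by (auto simp: B_set_def U_set_def)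
  then have ne: "?S \<noteq> {}" by blast
  have "(\<lambda>\<omega>. SUP x\<in>?S. (case x of (u1, u2) \<Rightarrow> \<bar>ln (Z \<omega> u2) - ln (Z \<omega> u1)\<bar>)) \<in> borel_measurable M"
  proof (rule borel_measurable_cSUP_continuous[OF ne])
    fix \<omega> assume \<omega>: "\<omega> \<in> space M"
    then have p: "path_extension \<Theta> \<theta>s A (H \<omega>) (Z \<omega>)" using Z by (simp add: Z_extension_iff)
    then have c: "continuous_on UNIV (Z \<omega>)" and pos: "\<And>u. u \<in> U_set \<Theta> \<theta>s A \<Longrightarrow> Z \<omega> u \<noteq> 0"
      by (auto simp: path_extension_def)
    have "continuous_on ?S (\<lambda>x. \<bar>ln (Z \<omega> (snd x)) - ln (Z \<omega> (fst x))\<bar>)"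
      using sub pos by (intro continuous_intros continuous_on_compose2[OF c]) auto
    then show "continuous_on ?S (\<lambda>x. case x of (u1, u2) \<Rightarrow> \<bar>ln (Z \<omega> u2) - ln (Z \<omega> u1)\<bar>)"
      by (simp add: case_prod_unfold)
    show "bdd_above ((\<lambda>x. case x of (u1, u2) \<Rightarrow> \<bar>ln (Z \<omega> u2) - ln (Z \<omega> u1)\<bar>) ` ?S)"
      by (rule log_increment_bdd[OF p H[OF \<omega>] b sub])
  next
    fix x assume "x \<in> ?S"
    note [measurable] = Z_extension_measurable_section[OF Z]
    show "(\<lambda>\<omega>. case x of (u1, u2) \<Rightarrow> \<bar>ln (Z \<omega> u2) - ln (Z \<omega> u1)\<bar>) \<in> borel_measurable M"
      by (cases x) simp
  qed
  then have "(\<lambda>\<omega>. w_modulus \<Theta> \<theta>s A (Z \<omega>) \<delta> c) \<in> borel_measurable M" by (simp add: w_modulus_def)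
  then show ?thesis unfolding W_event_def by measurable
qed

section \<open>Expected size of the tail and modulus events\<close>

text \<open>Since \<open>\<psi>\<close> is measurable for the conditioning field, it can be moved
  inside the conditional expectation.\<close>

lemma expectation_cond_probability:
  assumes M: "prob_space M" and C: "subalgebra M C" and [measurable]: "A \<in> sets M" "\<psi> \<in> borel_measurable C"
    and \<psi>: "\<And>\<omega>. \<omega> \<in> space M \<Longrightarrow> \<psi> \<omega> \<in> {0..1}"
  shows "(\<integral>\<omega>. cond_probability M C A \<omega> * \<psi> \<omega> \<partial>M) = (\<integral>\<omega>. indicator A \<omega> * \<psi> \<omega> \<partial>M)"
    and "AE \<omega> in M. 0 \<le> cond_probability M C A \<omega> * \<psi> \<omega> \<and> cond_probability M C A \<omega> * \<psi> \<omega> \<le> 1"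
    and "(\<lambda>\<omega>. cond_probability M C A \<omega> * \<psi> \<omega>) \<in> borel_measurable M"
proof -
  interpret prob_space M by fact
  interpret C: sigma_finite_subalgebra M C using M C by (rule prob_space_imp_sigma_finite_subalgebra)
  have [measurable]: "\<psi> \<in> borel_measurable M" by (rule measurable_from_subalg[OF C assms(4)])
  have i: "integrable M (\<lambda>\<omega>. \<psi> \<omega> * indicat_real A \<omega>)"
    using \<psi> by (intro integrable_const_bound[where B = 1]) (auto simp: indicator_def)
  show "(\<integral>\<omega>. cond_probability M C A \<omega> * \<psi> \<omega> \<partial>M) = (\<integral>\<omega>. indicator A \<omega> * \<psi> \<omega> \<partial>M)"
    using C.real_cond_exp_intg(2)[OF i] by (simp add: cond_probability_def mult.commute)
  have iA: "integrable M (indicat_real A)" by (simp add: emeasure_eq_measure)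
  have "AE \<omega> in M. 0 \<le> cond_probability M C A \<omega>" "AE \<omega> in M. cond_probability M C A \<omega> \<le> 1"
    unfolding cond_probability_def
    by (rule C.real_cond_exp_ge_c[OF iA], simp) (rule C.real_cond_exp_le_c[OF iA], simp)
  then show "AE \<omega> in M. 0 \<le> cond_probability M C A \<omega> * \<psi> \<omega> \<and> cond_probability M C A \<omega> * \<psi> \<omega> \<le> 1"
    using AE_space
  proof eventually_elim
    case (elim \<omega>)
    then show ?case using \<psi>[of \<omega>] mult_le_one[of "cond_probability M C A \<omega>" "\<psi> \<omega>"] by simp
  qed
  show "(\<lambda>\<omega>. cond_probability M C A \<omega> * \<psi> \<omega>) \<in> borel_measurable M"
    unfolding cond_probability_def by measurable
qed

text \<open>The left-hand side of the hypothesis is at most 1, so \<open>\<eta> r\<close> may be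
  replaced by \<open>min 1 (\<eta> r)\<close>, whose mean tends to 0 although \<open>\<eta> r\<close>
  need not be integrable.\<close>

lemma expectation_tail_uniformly_small:
  fixes \<eta> :: "nat \<Rightarrow> 'a \<Rightarrow> real" and A :: "nat \<Rightarrow> nat \<Rightarrow> 'a set"
  assumes M: "prob_space M" and C: "subalgebra M C" and A: "\<And>n r. A n r \<in> sets M" and \<psi>: "\<And>n. \<psi> n \<in> borel_measurable C"
    and \<psi>r: "\<And>n \<omega>. \<omega> \<in> space M \<Longrightarrow> \<psi> n \<omega> \<in> {0..1}"
    and [measurable]: "\<And>r. \<eta> r \<in> borel_measurable M" and \<eta>_pos: "\<And>r \<omega>. \<omega> \<in> space M \<Longrightarrow> \<eta> r \<omega> > 0"
    and \<eta>: "AE \<omega> in M. (\<lambda>r. \<eta> r \<omega>) \<longlonglongrightarrow> 0"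
    and le: "\<And>n r. AE \<omega> in M. cond_probability M C (A n r) \<omega> * \<psi> n \<omega> \<le> \<eta> r \<omega>"
    and "t > 0"
  shows "eventually (\<lambda>r. \<forall>n. (\<integral>\<omega>. indicator (A n r) \<omega> * \<psi> n \<omega> \<partial>M) < t) sequentially"
proof -
  interpret prob_space M by fact
  note E = expectation_cond_probability[OF M C A \<psi> \<psi>r]
  have min_bd: "norm (min 1 (\<eta> r \<omega>)) \<le> 1" if "\<omega> \<in> space M" for r \<omega>
    using \<eta>_pos[OF that, of r] by simp
  have "(\<lambda>r. \<integral>\<omega>. min 1 (\<eta> r \<omega>) \<partial>M) \<longlonglongrightarrow> (\<integral>\<omega>. 0 \<partial>M)"
  proof (rule integral_dominated_convergence[where w = "\<lambda>_. 1"])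
    show "AE \<omega> in M. (\<lambda>r. min 1 (\<eta> r \<omega>)) \<longlonglongrightarrow> 0"
      using \<eta>
    proof eventually_elim
      case (elim \<omega>)
      from tendsto_min[OF tendsto_const[of "1::real"] elim] show ?case by simp
    qed
    show "AE \<omega> in M. norm (min 1 (\<eta> r \<omega>)) \<le> 1" for r by (rule AE_I2) (rule min_bd)
  qed auto
  then have "eventually (\<lambda>r. (\<integral>\<omega>. min 1 (\<eta> r \<omega>) \<partial>M) < t) sequentially"
    using \<open>t > 0\<close> by (intro order_tendstoD(2)[of _ 0]) auto
  then show ?thesis
  proof eventually_elim
    case (elim r)
    have "(\<integral>\<omega>. cond_probability M C (A n r) \<omega> * \<psi> n \<omega> \<partial>M) \<le> (\<integral>\<omega>. min 1 (\<eta> r \<omega>) \<partial>M)" for n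
    proof (rule integral_mono_AE)
      have b: "AE \<omega> in M. 0 \<le> cond_probability M C (A n r) \<omega> * \<psi> n \<omega> \<and> cond_probability M C (A n r) \<omega> * \<psi> n \<omega> \<le> 1"
        by (rule E(2))
      show "integrable M (\<lambda>\<omega>. cond_probability M C (A n r) \<omega> * \<psi> n \<omega>)"
        using b by (intro integrable_const_bound[where B = 1] E(3)) auto
      show "integrable M (\<lambda>\<omega>. min 1 (\<eta> r \<omega>))"
        using min_bd by (intro integrable_const_bound[where B = 1]) auto
      show "AE \<omega> in M. cond_probability M C (A n r) \<omega> * \<psi> n \<omega> \<le> min 1 (\<eta> r \<omega>)"
        using b le[of n r] by eventually_elim auto
    qed
    then have "(\<integral>\<omega>. indicator (A n r) \<omega> * \<psi> n \<omega> \<partial>M) \<le> (\<integral>\<omega>. min 1 (\<eta> r \<omega>) \<partial>M)" for n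
      by (simp only: E(1))
    then show ?case using elim by (auto intro: le_less_trans)
  qed
qed

text \<open>The limit superior lies in \<open>[0, 1]\<close>, so it tends to 0 in mean as well, and
  the reverse Fatou inequality passes from the mean of the limit superior to the means
  themselves.\<close>

lemma expectation_modulus_eventually_small:
  fixes A :: "real \<Rightarrow> nat \<Rightarrow> 'a set"
  assumes M: "prob_space M" and C: "subalgebra M C" and A: "\<And>\<delta> n. \<delta> > 0 \<Longrightarrow> A \<delta> n \<in> sets M" and \<psi>: "\<And>n. \<psi> n \<in> borel_measurable C"
    and \<psi>r: "\<And>n \<omega>. \<omega> \<in> space M \<Longrightarrow> \<psi> n \<omega> \<in> {0..1}"
    and lim: "tendsto_in_prob M
          (\<lambda>\<delta> \<omega>. real_of_ereal (limsup (\<lambda>n. ereal (cond_probability M C (A \<delta> n) \<omega> * \<psi> n \<omega>))))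
          (\<lambda>\<omega>. 0) (at_right 0)"
    and "t > 0"
  shows "eventually (\<lambda>\<delta>. eventually (\<lambda>n. (\<integral>\<omega>. indicator (A \<delta> n) \<omega> * \<psi> n \<omega> \<partial>M) < t) sequentially) (at_right 0)"
proof -
  interpret prob_space M by fact
  note E = expectation_cond_probability[OF M C A \<psi> \<psi>r]
  let ?L = "\<lambda>\<delta> \<omega>. real_of_ereal (limsup (\<lambda>n. ereal (cond_probability M C (A \<delta> n) \<omega> * \<psi> n \<omega>)))"
  have L: "?L \<delta> \<in> borel_measurable M" "AE \<omega> in M. \<bar>?L \<delta> \<omega> - 0\<bar> \<le> 1" if "\<delta> > 0" for \<delta>
  proof -
    note [measurable] = E(3)[OF that]
    show "?L \<delta> \<in> borel_measurable M" by measurable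
    have "AE \<omega> in M. \<forall>n. 0 \<le> cond_probability M C (A \<delta> n) \<omega> * \<psi> n \<omega> \<and> cond_probability M C (A \<delta> n) \<omega> * \<psi> n \<omega> \<le> 1"
      using E(2)[OF that] by (simp add: AE_all_countable)
    then show "AE \<omega> in M. \<bar>?L \<delta> \<omega> - 0\<bar> \<le> 1"
    proof eventually_elim
      case (elim \<omega>)
      have "limsup (\<lambda>n. ereal (cond_probability M C (A \<delta> n) \<omega> * \<psi> n \<omega>)) \<le> 1"
        using elim by (intro Limsup_bounded) auto
      moreover have "0 \<le> limsup (\<lambda>n. ereal (cond_probability M C (A \<delta> n) \<omega> * \<psi> n \<omega>))"
        using elim by (intro le_Limsup) (auto intro: always_eventually)
      ultimately show ?case
        by (cases "limsup (\<lambda>n. ereal (cond_probability M C (A \<delta> n) \<omega> * \<psi> n \<omega>))") auto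
    qed
  qed
  have pos: "eventually (\<lambda>\<delta>::real. \<delta> > 0) (at_right 0)" by (rule eventually_at_right_less)
  have "((\<lambda>\<delta>. \<integral>\<omega>. \<bar>?L \<delta> \<omega> - 0\<bar> \<partial>M) \<longlongrightarrow> 0) (at_right 0)"
  proof (rule tendsto_in_prob_bounded_imp_L1[OF M lim])
    show "eventually (\<lambda>\<delta>. ?L \<delta> \<in> borel_measurable M \<and> (AE \<omega> in M. \<bar>?L \<delta> \<omega> - 0\<bar> \<le> 1)) (at_right 0)"
      using pos by eventually_elim (use L in blast)
  qed simp
  then have "eventually (\<lambda>\<delta>. (\<integral>\<omega>. \<bar>?L \<delta> \<omega> - 0\<bar> \<partial>M) < t) (at_right 0)"
    using \<open>t > 0\<close> by (intro order_tendstoD(2)[of _ 0]) auto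
  with pos show ?thesis
  proof eventually_elim
    case (elim \<delta>)
    have "(\<integral>\<omega>. ?L \<delta> \<omega> \<partial>M) \<le> (\<integral>\<omega>. \<bar>?L \<delta> \<omega> - 0\<bar> \<partial>M)"
      using integral_abs_bound[of M "?L \<delta>"] by simp
    then have "(\<integral>\<omega>. ?L \<delta> \<omega> \<partial>M) < t" using elim(2) by (rule le_less_trans)
    then have "eventually (\<lambda>n. (\<integral>\<omega>. cond_probability M C (A \<delta> n) \<omega> * \<psi> n \<omega> \<partial>M) < t) sequentially"
      by (rule reverse_Fatou_bounded[OF M E(3)[OF elim(1)] E(2)[OF elim(1)], rotated -1])
    then show ?case by (simp add: E(1)[OF elim(1)])
  qed
qed

section \<open>The penalised maximum of the rescaled field\<close>

text \<open>Off the tail event \<open>S_event\<close> and the modulus event \<open>W_event\<close>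
  the pathwise estimate \<open>penalised_max_near_argmax\<close> applies; on them the error is at most
  \<open>K\<close>. The radius \<open>r + 1\<close> leaves room for net points at distance less than 1
  from a maximiser of norm at most \<open>r\<close>.\<close>

lemma penalised_max_error:
  fixes \<Theta> :: "(real ^ 'p) set"
  assumes M: "prob_space M" and Z: "Z_extension M \<Theta> \<theta>s A H Z" and b\<Theta>: "bounded \<Theta>" and \<theta>s: "\<theta>s \<in> \<Theta>"
    and H: "\<And>\<omega>. \<omega> \<in> space M \<Longrightarrow> continuous_on (closure \<Theta>) (H \<omega>)" and A: "invertible A"
    and qmle: "is_qmle M \<Theta> H \<theta>h"
    and \<psi>[measurable]: "\<psi> \<in> borel_measurable M" and \<psi>r: "\<And>\<omega>. \<omega> \<in> space M \<Longrightarrow> \<psi> \<omega> \<in> {0..1}"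
    and ball: "ball 0 (r + 1) \<subseteq> U_set \<Theta> \<theta>s A" and er: "er \<le> 1" and "r \<ge> 0"
    and f: "continuous_on UNIV f" "\<And>v. f v \<in> {0..K}" and "\<delta> > 0" "\<delta> \<le> 1" "b \<ge> 0" "e \<ge> 0" "t \<ge> 0"
    and fmod: "\<And>v w. norm v \<le> r + 1 \<Longrightarrow> norm w \<le> r + 1 \<Longrightarrow> dist w v \<le> \<delta> \<Longrightarrow> dist (f w) (f v) \<le> t"
    and net: "\<And>u. norm u \<le> r \<Longrightarrow> \<exists>i\<le>m. dist (q i) u < \<delta>"
  shows "(\<integral>\<omega>. max 0 (f (matrix_inv A *v (\<theta>h \<omega> - \<theta>s))
            - penalised_max (\<lambda>i. f (q i)) b m (\<lambda>i. Z \<omega> (q i))) * \<psi> \<omega> \<partial>M)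
     \<le> t + b * e + K * ((\<integral>\<omega>. indicator (S_event M \<Theta> \<theta>s A Z r er) \<omega> * \<psi> \<omega> \<partial>M)
                       + (\<integral>\<omega>. indicator (W_event M \<Theta> \<theta>s A Z \<delta> (r + 1) e) \<omega> * \<psi> \<omega> \<partial>M))"
proof -
  interpret prob_space M by fact
  let ?u = "\<lambda>\<omega>. matrix_inv A *v (\<theta>h \<omega> - \<theta>s)"
  let ?p = "\<lambda>\<omega>. penalised_max (\<lambda>i. f (q i)) b m (\<lambda>i. Z \<omega> (q i))"
  let ?S = "S_event M \<Theta> \<theta>s A Z r er" and ?W = "W_event M \<Theta> \<theta>s A Z \<delta> (r + 1) e"
  have [measurable]: "?S \<in> sets M" "?W \<in> sets M"
    using assms by (auto intro!: S_event_sets W_event_sets)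
  have [measurable]: "f \<in> borel_measurable borel" by (rule borel_measurable_continuous_onI[OF f(1)])
  have [measurable]: "\<theta>h \<in> borel_measurable M" using qmle by (simp add: is_qmle_def)
  have [measurable]: "(*v) (matrix_inv A) \<in> borel_measurable borel"
    by (intro borel_measurable_continuous_onI continuous_intros)
  note [measurable] = Z_extension_measurable_section[OF Z]
  have [measurable]: "?p \<in> borel_measurable M" unfolding penalised_max_def by measurable
  have K: "K \<ge> 0" using f(2)[of 0] by auto
  have p: "?p \<omega> \<in> {0..K}" for \<omega> by (rule penalised_max_bounds) (use f \<open>b \<ge> 0\<close> in auto)
  have d: "max 0 (f (?u \<omega>) - ?p \<omega>) \<in> {0..K}" for \<omega> using f(2)[of "?u \<omega>"] p[of \<omega>] K by auto
  have good: "f (?u \<omega>) - ?p \<omega> \<le> t + b * e" if \<omega>: "\<omega> \<in> space M" "\<omega> \<notin> ?S" "\<omega> \<notin> ?W" for \<omega>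
  proof -
    have pe: "path_extension \<Theta> \<theta>s A (H \<omega>) (Z \<omega>)" using Z \<omega> by (simp add: Z_extension_iff)
    have am: "is_arg_max (H \<omega>) (\<lambda>\<theta>. \<theta> \<in> closure \<Theta>) (\<theta>h \<omega>)" using qmle \<omega> by (simp add: is_qmle_def)
    note mx = path_extension_maximum[OF pe H[OF \<omega>(1)] A \<theta>s am]
    have u: "norm (?u \<omega>) \<le> r"
      using \<omega> er by (intro localised_maximum[OF pe \<theta>s mx, of r er]) (auto simp: S_event_def)
    have B: "v \<in> B_set \<Theta> \<theta>s A (r + 1)" if "norm v < r + 1" for v
      using ball that by (auto simp: B_set_def U_set_def)
    have "f (?u \<omega>) \<le> ?p \<omega> + t + b * e"
    proof (rule penalised_max_near_argmax[where z = "Z \<omega>" and u = "?u \<omega>", OF mx(2) u])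
      show "Z \<omega> v > 0" if "norm v < r + 1" for v
      proof -
        have "v \<in> U_set \<Theta> \<theta>s A" using ball that by auto
        then show ?thesis using pe by (simp add: path_extension_def)
      qed
      show "\<bar>ln (Z \<omega> w) - ln (Z \<omega> v)\<bar> \<le> e" if "norm v < r + 1" "norm w < r + 1" "norm (w - v) \<le> \<delta>" for v w
        using log_increment_le_w_modulus[OF pe H[OF \<omega>(1)] b\<Theta> B[OF that(1)] B[OF that(2)] that(3)] \<omega>
        by (auto simp: W_event_def)
    qed (use fmod net[OF u] \<open>\<delta> \<le> 1\<close> \<open>b \<ge> 0\<close> in auto)
    then show ?thesis by linarith
  qed
  have iS: "integrable M (\<lambda>\<omega>. indicator ?S \<omega> * \<psi> \<omega>)" "integrable M (\<lambda>\<omega>. indicator ?W \<omega> * \<psi> \<omega>)"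
    using \<psi>r by (auto intro!: integrable_const_bound[where B = 1] simp: indicator_def)
  have iD: "integrable M (\<lambda>\<omega>. max 0 (f (?u \<omega>) - ?p \<omega>) * \<psi> \<omega>)"
  proof (rule integrable_const_bound[where B = "K * 1"])
    show "AE \<omega> in M. norm (max 0 (f (?u \<omega>) - ?p \<omega>) * \<psi> \<omega>) \<le> K * 1"
    proof (rule AE_I2)
      fix \<omega> assume "\<omega> \<in> space M"
      from \<psi>r[OF this] d[of \<omega>] show "norm (max 0 (f (?u \<omega>) - ?p \<omega>) * \<psi> \<omega>) \<le> K * 1"
        unfolding norm_mult by (intro mult_mono) auto
    qed
  qed measurable
  have "(\<integral>\<omega>. max 0 (f (?u \<omega>) - ?p \<omega>) * \<psi> \<omega> \<partial>M)
      \<le> (\<integral>\<omega>. (t + b * e) + K * (indicator ?S \<omega> * \<psi> \<omega> + indicator ?W \<omega> * \<psi> \<omega>) \<partial>M)"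
  proof (rule integral_mono[OF iD])
    fix \<omega> assume \<omega>: "\<omega> \<in> space M"
    have be: "0 \<le> b * e" using \<open>b \<ge> 0\<close> \<open>e \<ge> 0\<close> by simp
    have \<psi>: "0 \<le> \<psi> \<omega>" "\<psi> \<omega> \<le> 1" using \<psi>r[OF \<omega>] by auto
    show "max 0 (f (?u \<omega>) - ?p \<omega>) * \<psi> \<omega> \<le> (t + b * e) + K * (indicator ?S \<omega> * \<psi> \<omega> + indicator ?W \<omega> * \<psi> \<omega>)"
    proof (cases "\<omega> \<in> ?S \<or> \<omega> \<in> ?W")
      case True
      have "max 0 (f (?u \<omega>) - ?p \<omega>) * \<psi> \<omega> \<le> K * \<psi> \<omega>" using d[of \<omega>] \<psi> by (intro mult_right_mono) auto
      also have "\<dots> \<le> K * (indicator ?S \<omega> * \<psi> \<omega> + indicator ?W \<omega> * \<psi> \<omega>)"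
        using True K \<psi> by (intro mult_left_mono) (auto simp: indicator_def)
      finally show ?thesis using be \<open>t \<ge> 0\<close> by linarith
    next
      case False
      then have "max 0 (f (?u \<omega>) - ?p \<omega>) \<le> t + b * e" using good[OF \<omega>] be \<open>t \<ge> 0\<close> by auto
      then have "max 0 (f (?u \<omega>) - ?p \<omega>) * \<psi> \<omega> \<le> (t + b * e) * 1" using \<psi> be \<open>t \<ge> 0\<close> by (intro mult_mono) auto
      then show ?thesis using False by simp
    qed
  qed (use iS in auto)
  also have "\<dots> = (t + b * e) + K * ((\<integral>\<omega>. indicator ?S \<omega> * \<psi> \<omega> \<partial>M) + (\<integral>\<omega>. indicator ?W \<omega> * \<psi> \<omega> \<partial>M))"
    using iS by (simp add: prob_space)
  finally show ?thesis .
qed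

text \<open>The constants are chosen one after the other: the radius \<open>r\<close> from the tail
  condition, the modulus level \<open>e\<close> from the penalty \<open>b\<close>, the distance
  \<open>\<delta>\<close> from uniform continuity of \<open>f\<close> on the ball and from the modulus
  condition at level \<open>e\<close>, and then the number of points that form a
  \<open>\<delta>\<close>-net of the ball. Only after that does the stage \<open>n\<close> tend to
  infinity.\<close>

lemma penalised_max_error_eventually_small:
  fixes \<Theta> :: "(real ^ 'p) set" and A :: "nat \<Rightarrow> real ^ 'p ^ 'p" and q :: "nat \<Rightarrow> real ^ 'p"
  assumes M: "prob_space M" and C: "subalgebra M C" and \<Theta>: "open \<Theta>" "bounded \<Theta>" "\<theta>s \<in> \<Theta>"
    and Z: "\<And>n. Z_extension M \<Theta> \<theta>s (A n) (H n) (Z n)"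
    and H: "\<And>n \<omega>. \<omega> \<in> space M \<Longrightarrow> continuous_on (closure \<Theta>) (H n \<omega>)"
    and A: "\<And>n. invertible (A n)" "A \<longlonglongrightarrow> 0"
    and qmle: "\<And>n. is_qmle M \<Theta> (H n) (\<theta>h n)"
    and \<psi>: "\<And>n. \<psi> n \<in> borel_measurable C" and \<psi>r: "\<And>n \<omega>. \<omega> \<in> space M \<Longrightarrow> \<psi> n \<omega> \<in> {0..1}"
    and \<epsilon>: "\<epsilon> \<longlonglongrightarrow> 0"
    and \<eta>: "\<And>r. \<eta> r \<in> borel_measurable M" "\<And>r \<omega>. \<omega> \<in> space M \<Longrightarrow> \<eta> r \<omega> > 0" "AE \<omega> in M. (\<lambda>r. \<eta> r \<omega>) \<longlonglongrightarrow> 0"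
    and tail: "\<And>n r. AE \<omega> in M. cond_probability M C (S_event M \<Theta> \<theta>s (A n) (Z n) (real r) (\<epsilon> r)) \<omega> * \<psi> n \<omega> \<le> \<eta> r \<omega>"
    and modulus: "\<And>e c. e > 0 \<Longrightarrow> c > 0 \<Longrightarrow> tendsto_in_prob M
          (\<lambda>\<delta> \<omega>. real_of_ereal (limsup (\<lambda>n. ereal
             (cond_probability M C (W_event M \<Theta> \<theta>s (A n) (Z n) \<delta> c e) \<omega> * \<psi> n \<omega>))))
          (\<lambda>\<omega>. 0) (at_right 0)"
    and f: "continuous_on UNIV f" "\<And>v. f v \<in> {0..K}" and q: "closure (range q) = UNIV"
    and "b \<ge> 0" "t > 0"
  shows "\<exists>m0. \<forall>m\<ge>m0. eventually (\<lambda>n. (\<integral>\<omega>. max 0 (f (matrix_inv (A n) *v (\<theta>h n \<omega> - \<theta>s))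
            - penalised_max (\<lambda>i. f (q i)) b m (\<lambda>i. Z n \<omega> (q i))) * \<psi> n \<omega> \<partial>M) \<le> t) sequentially"
proof -
  have K: "K \<ge> 0" using f(2)[of 0] by auto
  \<comment> \<open>The total error will be at most \<open>s\<close> from \<open>f\<close>, \<open>b
    * e \<le> s\<close> from the charge and \<open>K * (s + s)\<close> from the two events.\<close>
  define s where "s = t / (2 + 2 * K)"
  have s: "s > 0" "s * (2 + 2 * K) = t" using \<open>t > 0\<close> K by (auto simp: s_def)
  define e where "e = s / (b + 1)"
  have e: "e > 0" using s \<open>b \<ge> 0\<close> by (simp add: e_def)
  have "e * (b + 1) = s" using \<open>b \<ge> 0\<close> by (simp add: e_def)
  then have be: "b * e \<le> s" using e by (simp add: algebra_simps)
  have "eventually (\<lambda>r. \<forall>n. (\<integral>\<omega>. indicator (S_event M \<Theta> \<theta>s (A n) (Z n) (real r) (\<epsilon> r)) \<omega> * \<psi> n \<omega> \<partial>M) < s) sequentially"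
    by (rule expectation_tail_uniformly_small[OF M C _ \<psi> \<psi>r \<eta> tail s(1)]) (auto intro: S_event_sets[OF Z])
  moreover have "eventually (\<lambda>r. \<epsilon> r < 1) sequentially" using \<epsilon> by (rule order_tendstoD) simp
  ultimately have "eventually (\<lambda>r. (\<forall>n. (\<integral>\<omega>. indicator (S_event M \<Theta> \<theta>s (A n) (Z n) (real r) (\<epsilon> r)) \<omega> * \<psi> n \<omega> \<partial>M) < s)
      \<and> \<epsilon> r < 1) sequentially" by eventually_elim blast
  then obtain r where r: "\<And>n. (\<integral>\<omega>. indicator (S_event M \<Theta> \<theta>s (A n) (Z n) (real r) (\<epsilon> r)) \<omega> * \<psi> n \<omega> \<partial>M) < s" "\<epsilon> r < 1"
    unfolding eventually_sequentially by blast
  have "uniformly_continuous_on (cball 0 (real r + 1)) f"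
    by (intro compact_uniformly_continuous continuous_on_subset[OF f(1)]) auto
  then obtain d where d: "d > 0" "\<And>v w. norm v \<le> real r + 1 \<Longrightarrow> norm w \<le> real r + 1 \<Longrightarrow> dist w v < d \<Longrightarrow> dist (f w) (f v) < s"
    unfolding uniformly_continuous_on_def using s(1) by (auto simp: dist_norm)
  have "eventually (\<lambda>\<delta>. eventually (\<lambda>n. (\<integral>\<omega>. indicator (W_event M \<Theta> \<theta>s (A n) (Z n) \<delta> (real r + 1) e) \<omega> * \<psi> n \<omega> \<partial>M) < s)
      sequentially) (at_right 0)"
    by (rule expectation_modulus_eventually_small[OF M C _ \<psi> \<psi>r modulus[OF e] s(1)])
      (auto intro!: W_event_sets[OF Z H] \<Theta>)
  moreover have "eventually (\<lambda>\<delta>::real. 0 < \<delta> \<and> \<delta> < min d 1) (at_right 0)"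
    using d(1) unfolding eventually_at_right_field by (intro exI[of _ "min d 1"]) auto
  ultimately have "eventually (\<lambda>\<delta>. eventually (\<lambda>n. (\<integral>\<omega>. indicator (W_event M \<Theta> \<theta>s (A n) (Z n) \<delta> (real r + 1) e) \<omega> * \<psi> n \<omega> \<partial>M) < s)
      sequentially \<and> 0 < \<delta> \<and> \<delta> < min d 1) (at_right 0)" by eventually_elim blast
  from eventually_happens'[OF trivial_limit_at_right_real this]
  obtain \<delta> where \<delta>: "0 < \<delta>" "\<delta> < d" "\<delta> < 1"
    and W: "eventually (\<lambda>n. (\<integral>\<omega>. indicator (W_event M \<Theta> \<theta>s (A n) (Z n) \<delta> (real r + 1) e) \<omega> * \<psi> n \<omega> \<partial>M) < s) sequentially"
    by auto
  obtain m0 where "\<forall>u\<in>cball 0 (real r). \<exists>i\<le>m0. dist (q i) u < \<delta>"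
    using finite_net_of_dense_sequence[OF q compact_cball \<delta>(1)] by blast
  then have m0: "\<exists>i\<le>m0. dist (q i) u < \<delta>" if "norm u \<le> real r" for u
    using that by simp
  have "eventually (\<lambda>n. (\<integral>\<omega>. max 0 (f (matrix_inv (A n) *v (\<theta>h n \<omega> - \<theta>s))
            - penalised_max (\<lambda>i. f (q i)) b m (\<lambda>i. Z n \<omega> (q i))) * \<psi> n \<omega> \<partial>M) \<le> t) sequentially" if "m \<ge> m0" for m
    using W ball_subset_U_set[OF A(2) \<Theta>(1,3), of "real r + 1"]
  proof eventually_elim
    case (elim n)
    let ?IS = "\<integral>\<omega>. indicator (S_event M \<Theta> \<theta>s (A n) (Z n) (real r) (\<epsilon> r)) \<omega> * \<psi> n \<omega> \<partial>M"
    let ?IW = "\<integral>\<omega>. indicator (W_event M \<Theta> \<theta>s (A n) (Z n) \<delta> (real r + 1) e) \<omega> * \<psi> n \<omega> \<partial>M"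
    have "(\<integral>\<omega>. max 0 (f (matrix_inv (A n) *v (\<theta>h n \<omega> - \<theta>s))
            - penalised_max (\<lambda>i. f (q i)) b m (\<lambda>i. Z n \<omega> (q i))) * \<psi> n \<omega> \<partial>M) \<le> s + b * e + K * (?IS + ?IW)"
    proof (rule penalised_max_error[OF M Z \<Theta>(2,3) H A(1) qmle measurable_from_subalg[OF C \<psi>] \<psi>r elim(2)])
      show "dist (f w) (f v) \<le> s" if "norm v \<le> real r + 1" "norm w \<le> real r + 1" "dist w v \<le> \<delta>" for v w
        using d(2)[OF that(1,2)] that(3) \<delta>(2) by auto
      show "\<exists>i\<le>m. dist (q i) u < \<delta>" if "norm u \<le> real r" for u
        using m0[OF that] \<open>m \<ge> m0\<close> by (meson order_trans)
    qed (use f r \<delta> e s \<open>b \<ge> 0\<close> in auto)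
    also have "\<dots> \<le> s + s + K * (s + s)"
      using be r(1)[of n] elim(1) K by (intro add_mono mult_left_mono) auto
    also have "\<dots> = t" using s(2) by (simp add: algebra_simps)
    finally show ?case .
  qed
  then show ?thesis by blast
qed

section \<open>Convergence of the quasi maximum likelihood estimator\<close>

theorem theorem2p2:
  fixes M C G :: "'a measure" and Mb :: "'b measure" and pr :: "'b \<Rightarrow> 'a"
    and TT :: "real set" and T0 :: real
    and \<Theta> :: "(real ^ 'p) set" and \<theta>s :: "real ^ 'p"
    and H Z :: "real \<Rightarrow> 'a \<Rightarrow> real ^ 'p \<Rightarrow> real"
    and a :: "real \<Rightarrow> real ^ 'p ^ 'p"
    and \<theta>h uh :: "real \<Rightarrow> 'a \<Rightarrow> real ^ 'p"
    and \<Psi> :: "real \<Rightarrow> 'a \<Rightarrow> real"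
    and \<epsilon> :: "nat \<Rightarrow> real" and \<eta> :: "nat \<Rightarrow> 'a \<Rightarrow> real"
    and Zlim :: "'b \<Rightarrow> ((real ^ 'p) \<Rightarrow>\<^sub>C real)" and ulim :: "'b \<Rightarrow> real ^ 'p"
  defines "uh \<equiv> \<lambda>T \<omega>. matrix_inv (a T) *v (\<theta>h T \<omega> - \<theta>s)"
  assumes "prob_space M"
    and "TT \<subseteq> {0..}" and "\<not> bdd_above TT"
    and "open \<Theta>" and "connected \<Theta>" and "bounded \<Theta>" and "\<theta>s \<in> \<Theta>"
    and H_meas: "\<And>T. T \<in> TT \<Longrightarrow>
        (\<lambda>(\<omega>, \<theta>). H T \<omega> \<theta>) \<in> borel_measurable (M \<Otimes>\<^sub>M restrict_space borel (closure \<Theta>))"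
    and H_cont: "\<And>T \<omega>. T \<in> TT \<Longrightarrow> \<omega> \<in> space M \<Longrightarrow> continuous_on (closure \<Theta>) (H T \<omega>)"
    and a_inv: "\<And>T. T \<in> TT \<Longrightarrow> invertible (a T)"
    and a_lim: "(a \<longlongrightarrow> 0) (at_top_in TT)"
    and Z_ext: "\<And>T. T \<in> TT \<Longrightarrow> Z_extension M \<Theta> \<theta>s (a T) (H T) (Z T)"
    and qmle: "\<And>T. T \<in> TT \<Longrightarrow> is_qmle M \<Theta> (H T) (\<theta>h T)"
    and "subalgebra M G" and "subalgebra G C"
    and \<Psi>_meas: "\<And>T. T \<in> TT \<Longrightarrow> \<Psi> T \<in> borel_measurable C"
    and \<Psi>_range: "\<And>T \<omega>. T \<in> TT \<Longrightarrow> \<omega> \<in> space M \<Longrightarrow> \<Psi> T \<omega> \<in> {0..1}"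
    and "T0 > 0"
    and "prob_extension M Mb pr"
    and Zlim_meas: "Zlim \<in> measurable Mb (restrict_space borel C_hat)"
    and ulim_meas: "ulim \<in> borel_measurable Mb"
    \<comment> \<open>(1)\<close>
    and "\<And>r. \<epsilon> r > 0" and "\<epsilon> \<longlonglongrightarrow> 0"
    and "\<And>r. \<eta> r \<in> borel_measurable M" and "\<And>r \<omega>. \<omega> \<in> space M \<Longrightarrow> \<eta> r \<omega> > 0"
    and "AE \<omega> in M. (\<lambda>r. \<eta> r \<omega>) \<longlonglongrightarrow> 0"
    and cond1: "\<And>\<tau> n r. \<tau> \<in> admissible_seqs TT T0 \<Longrightarrow>
        AE \<omega> in M. cond_probability M C (S_event M \<Theta> \<theta>s (a (\<tau> n)) (Z (\<tau> n)) (real r) (\<epsilon> r)) \<omega>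
                     * \<Psi> (\<tau> n) \<omega> \<le> \<eta> r \<omega>"
    \<comment> \<open>(2)\<close>
    and cond2: "\<And>e c \<tau>. e > 0 \<Longrightarrow> c > 0 \<Longrightarrow> \<tau> \<in> admissible_seqs TT T0 \<Longrightarrow>
        tendsto_in_prob M
          (\<lambda>\<delta> \<omega>. real_of_ereal (limsup (\<lambda>n. ereal
             (cond_probability M C (W_event M \<Theta> \<theta>s (a (\<tau> n)) (Z (\<tau> n)) \<delta> c e) \<omega> * \<Psi> (\<tau> n) \<omega>))))
          (\<lambda>\<omega>. 0) (at_right 0)"
    \<comment> \<open>(3)\<close>
    and cond3i: "\<And>(k :: nat) (u :: nat \<Rightarrow> real ^ 'p) (f :: (nat \<Rightarrow> real) \<Rightarrow> real) (Y :: 'a \<Rightarrow> real).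
        continuous_map (Euclidean_space k) euclideanreal f \<Longrightarrow>
        bounded (f ` topspace (Euclidean_space k)) \<Longrightarrow>
        Y \<in> borel_measurable G \<Longrightarrow> bounded (Y ` space G) \<Longrightarrow>
        tendsto_in_prob Mb
          (\<lambda>T w. real_cond_exp M C
             (\<lambda>\<omega>. f (\<lambda>i. if i < k then Z T \<omega> (u i) else 0) * \<Psi> T \<omega> * Y \<omega>) (pr w))
          (ext_cond_exp Mb pr C
             (\<lambda>w. f (\<lambda>i. if i < k then apply_bcontfun (Zlim w) (u i) else 0) * Y (pr w)))
          (at_top_in TT)"
    and cond3ii: "tendsto_in_prob M \<Psi> (\<lambda>\<omega>. 1) (at_top_in TT)"
    \<comment> \<open>(4)\<close>
    and cond4: "AE w in Mb. (\<exists>!u. is_arg_max (apply_bcontfun (Zlim w)) (\<lambda>_. True) u) \<and>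
                   is_arg_max (apply_bcontfun (Zlim w)) (\<lambda>_. True) (ulim w)"
  shows "(\<forall>(f :: real ^ 'p \<Rightarrow> real) (Y :: 'a \<Rightarrow> real).
            continuous_on UNIV f \<longrightarrow> bounded (range f) \<longrightarrow>
            Y \<in> borel_measurable G \<longrightarrow> bounded (Y ` space G) \<longrightarrow>
            tendsto_in_prob Mb
              (\<lambda>T w. real_cond_exp M C (\<lambda>\<omega>. f (uh T \<omega>) * Y \<omega>) (pr w))
              (ext_cond_exp Mb pr C (\<lambda>w. f (ulim w) * Y (pr w)))
              (at_top_in TT))
         \<and> stable_conv M G Mb pr uh ulim (at_top_in TT)"
proof -
  note M = \<open>prob_space M\<close> and ext = \<open>prob_extension M Mb pr\<close> and \<Theta> = \<open>open \<Theta>\<close> \<open>bounded \<Theta>\<close> \<open>\<theta>s \<in> \<Theta>\<close>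
  have Mb: "prob_space Mb" and pr[measurable]: "pr \<in> measurable Mb M" and distr: "distr Mb M pr = M"
    using ext by (auto simp: prob_extension_def)
  interpret M: prob_space M by fact
  interpret Mb: prob_space Mb by fact
  have G: "subalgebra M G" and GC: "subalgebra G C" by fact+
  then have C: "subalgebra M C" by (auto simp: subalgebra_def)
  define F where "F = vimage_algebra (space Mb) pr C"
  have F: "subalgebra Mb F" unfolding F_def by (rule subalgebra_vimage[OF pr C])
  interpret F: sigma_finite_subalgebra Mb F by (rule prob_space_imp_sigma_finite_subalgebra[OF Mb F])
  have sp: "space G = space M" using G by (simp add: subalgebra_def)
  have prs: "pr w \<in> space M" if "w \<in> space Mb" for w using measurable_space[OF pr that] .
  have prG[measurable]: "pr \<in> measurable Mb G" by (rule measurable_into_subalgebra[OF G pr])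
  have transfer: "(\<integral>w. h (pr w) \<partial>Mb) = (\<integral>x. h x \<partial>M)" if "h \<in> borel_measurable M" for h :: "_ \<Rightarrow> real"
    using integral_distr[OF pr that] distr by simp
  have \<Psi>M: "\<Psi> T \<in> borel_measurable M" if "T \<in> TT" for T using \<Psi>_meas[OF that] by (rule measurable_from_subalg[OF C])
  have zl[measurable]: "(\<lambda>w. apply_bcontfun (Zlim w) u) \<in> borel_measurable Mb" for u
    using Zlim_meas by (intro borel_measurable_apply_bcontfun) (simp add: measurable_restrict_space2_iff)
  have zl_inf: "(apply_bcontfun (Zlim w) \<longlongrightarrow> 0) at_infinity" if "w \<in> space Mb" for w
    using Zlim_meas that by (auto simp: measurable_restrict_space2_iff C_hat_def)
  note [measurable] = ulim_meas

  have \<theta>hm: "\<theta>h T \<in> borel_measurable M" if "T \<in> TT" for T using qmle[OF that] by (simp add: is_qmle_def)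
  have uh_meas: "uh T \<in> borel_measurable M" if "T \<in> TT" for T
  proof -
    note [measurable] = \<theta>hm[OF that]
    have [measurable]: "(*v) (matrix_inv (a T)) \<in> borel_measurable borel"
      by (intro borel_measurable_continuous_onI continuous_intros)
    show ?thesis unfolding uh_def by measurable
  qed

  \<comment> \<open>Finite-dimensional convergence, transferred to the extended space and
    strengthened to convergence in mean.\<close>
  have fidi: "(\<lambda>n. \<integral>w. \<bar>real_cond_exp Mb F (\<lambda>w. f (\<lambda>i. if i < k then Z (\<tau> n) (pr w) (u i) else 0) * \<Psi> (\<tau> n) (pr w) * Y (pr w)) w
        - real_cond_exp Mb F (\<lambda>w. f (\<lambda>i. if i < k then apply_bcontfun (Zlim w) (u i) else 0) * Y (pr w)) w\<bar> \<partial>Mb) \<longlonglongrightarrow> 0"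
    if \<tau>: "\<tau> \<in> admissible_seqs TT T0" and f: "continuous_on UNIV f" "\<And>x. f x \<in> {0..K}"
      and Y: "Y \<in> borel_measurable G" "\<And>\<omega>. \<omega> \<in> space G \<Longrightarrow> Y \<omega> \<in> {0..B}"
    for \<tau> and k :: nat and u and f :: "(nat \<Rightarrow> real) \<Rightarrow> real" and Y K B
  proof -
    have TT: "\<tau> n \<in> TT" for n using \<tau> by (auto simp: admissible_seqs_def)
    have [measurable]: "f \<in> borel_measurable borel" by (rule borel_measurable_continuous_onI[OF f(1)])
    have [measurable]: "Y \<in> borel_measurable M" by (rule measurable_from_subalg[OF G Y(1)])
    note [measurable] = \<Psi>M[OF TT] Z_extension_measurable_section[OF Z_ext[OF TT]]
    let ?v = "\<lambda>n \<omega>. f (\<lambda>i. if i < k then Z (\<tau> n) \<omega> (u i) else 0) * \<Psi> (\<tau> n) \<omega> * Y \<omega>"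
    let ?l = "\<lambda>w. f (\<lambda>i. if i < k then apply_bcontfun (Zlim w) (u i) else 0) * Y (pr w)"
    have [measurable]: "(\<lambda>\<omega> i. if i < k then Z (\<tau> n) \<omega> (u i) else 0) \<in> borel_measurable M" for n
      by (rule measurable_coordinatewise_then_product) simp
    have [measurable]: "(\<lambda>w i. if i < k then apply_bcontfun (Zlim w) (u i) else 0) \<in> borel_measurable Mb"
      by (rule measurable_coordinatewise_then_product) simp
    have vm[measurable]: "?v n \<in> borel_measurable M" for n by measurable
    have lm[measurable]: "?l \<in> borel_measurable Mb" by measurable
    have K: "0 \<le> K" using f(2)[of "\<lambda>_. 0"] by auto
    have vb: "\<bar>?v n \<omega>\<bar> \<le> K * 1 * B" if "\<omega> \<in> space M" for n \<omega>
      unfolding abs_mult using f(2) K \<Psi>_range[OF TT that, of n] Y(2)[of \<omega>] that sp by (intro mult_mono) auto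
    have lb: "\<bar>?l w\<bar> \<le> K * B" if "w \<in> space Mb" for w
      unfolding abs_mult using f(2) K Y(2)[of "pr w"] prs[OF that] sp by (intro mult_mono) auto
    have vi: "integrable M (?v n)" for n by (rule bounded_prob_integrable[OF M vm vb])
    have pull: "AE w in Mb. real_cond_exp M C (?v n) (pr w) = real_cond_exp Mb F (\<lambda>w. ?v n (pr w)) w" for n
      using real_cond_exp_pullback[OF M ext C vi] by (simp add: ext_cond_exp_def F_def)
    have cm: "(\<lambda>w. real_cond_exp M C (?v n) (pr w)) \<in> borel_measurable Mb" for n by measurable
    have "bounded (f ` topspace (Euclidean_space k))" by (rule bounded_image_Icc, rule f(2))
    moreover have "bounded (Y ` space G)" by (rule bounded_image_Icc, rule Y(2))
    moreover have "continuous_map (Euclidean_space k) euclideanreal f"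
      unfolding continuous_map_Euclidean_space_iff by (rule continuous_on_subset[OF f(1)]) simp
    ultimately have "tendsto_in_prob Mb (\<lambda>T w. real_cond_exp M C
             (\<lambda>\<omega>. f (\<lambda>i. if i < k then Z T \<omega> (u i) else 0) * \<Psi> T \<omega> * Y \<omega>) (pr w))
          (ext_cond_exp Mb pr C ?l) (at_top_in TT)" using Y(1) by (intro cond3i)
    then have lim: "tendsto_in_prob Mb (\<lambda>n w. real_cond_exp M C (?v n) (pr w)) (real_cond_exp Mb F ?l) sequentially"
      unfolding tendsto_in_prob_def ext_cond_exp_def F_def
      using filterlim_compose[OF _ filterlim_admissible[OF \<tau>]] by blast
    have "(\<lambda>n. \<integral>w. \<bar>real_cond_exp M C (?v n) (pr w) - real_cond_exp Mb F ?l w\<bar> \<partial>Mb) \<longlonglongrightarrow> 0"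
    proof (rule tendsto_in_prob_bounded_imp_L1[OF Mb lim])
      have "AE w in Mb. \<bar>real_cond_exp M C (?v n) (pr w) - real_cond_exp Mb F ?l w\<bar> \<le> K * 1 * B + K * B" for n
      proof -
        have "(\<lambda>w. ?v n (pr w)) \<in> borel_measurable Mb" by measurable
        moreover have "\<bar>?v n (pr w)\<bar> \<le> K * 1 * B" if "w \<in> space Mb" for w by (rule vb[OF prs[OF that]])
        ultimately have "AE w in Mb. \<bar>real_cond_exp Mb F (\<lambda>w. ?v n (pr w)) w\<bar> \<le> K * 1 * B"
          by (rule real_cond_exp_bounded[OF Mb F])
        moreover have "AE w in Mb. \<bar>real_cond_exp Mb F ?l w\<bar> \<le> K * B"
          using lb by (rule real_cond_exp_bounded[OF Mb F lm])
        ultimately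
        show ?thesis using pull[of n] by eventually_elim linarith
      qed
      then show "eventually (\<lambda>n. (\<lambda>w. real_cond_exp M C (?v n) (pr w)) \<in> borel_measurable Mb \<and>
          (AE w in Mb. \<bar>real_cond_exp M C (?v n) (pr w) - real_cond_exp Mb F ?l w\<bar> \<le> K * 1 * B + K * B)) sequentially"
        using cm by simp
    qed simp
    moreover have "(\<integral>w. \<bar>real_cond_exp M C (?v n) (pr w) - real_cond_exp Mb F ?l w\<bar> \<partial>Mb)
        = (\<integral>w. \<bar>real_cond_exp Mb F (\<lambda>w. ?v n (pr w)) w - real_cond_exp Mb F ?l w\<bar> \<partial>Mb)" for n
      using pull[of n] cm[of n] by (intro integral_cong_AE) auto
    ultimately show ?thesis by simp
  qed

  \<comment> \<open>The test function \<open>min 1 \<bar>x - 1\<bar>\<close> vanishes at \<open>Z T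
    \<omega> 0 = 1\<close>, so its mean under the limit is 0.\<close>
  have zl_0: "AE w in Mb. apply_bcontfun (Zlim w) 0 = 1"
  proof -
    obtain \<tau> where \<tau>: "\<tau> \<in> admissible_seqs TT T0" using admissible_seq_exists[OF \<open>\<not> bdd_above TT\<close>] by blast
    then have TT: "\<tau> n \<in> TT" for n by (auto simp: admissible_seqs_def)
    let ?f = "\<lambda>x :: nat \<Rightarrow> real. min 1 \<bar>x 0 - 1\<bar>"
    let ?g = "\<lambda>w. min 1 \<bar>apply_bcontfun (Zlim w) 0 - 1\<bar>"
    have "continuous_on UNIV ?f" by (intro continuous_intros continuous_on_product_coordinates)
    from fidi[OF \<tau> this, of 1 "\<lambda>_. 1" 1 1 "\<lambda>_. 0"]
    have "(\<lambda>n. \<integral>w. \<bar>real_cond_exp Mb F (\<lambda>w. min 1 \<bar>Z (\<tau> n) (pr w) 0 - 1\<bar> * \<Psi> (\<tau> n) (pr w)) w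
        - real_cond_exp Mb F ?g w\<bar> \<partial>Mb) \<longlonglongrightarrow> 0" by simp
    moreover have "(\<integral>w. \<bar>real_cond_exp Mb F (\<lambda>w. min 1 \<bar>Z (\<tau> n) (pr w) 0 - 1\<bar> * \<Psi> (\<tau> n) (pr w)) w
        - real_cond_exp Mb F ?g w\<bar> \<partial>Mb) = (\<integral>w. \<bar>real_cond_exp Mb F ?g w\<bar> \<partial>Mb)" for n
    proof -
      note [measurable] = \<Psi>M[OF TT] Z_extension_measurable_section[OF Z_ext[OF TT]]
      have 1: "Z (\<tau> n) (pr w) 0 = 1" if "w \<in> space Mb" for w
        using Z_ext[OF TT] prs[OF that] \<open>\<theta>s \<in> \<Theta>\<close> by (auto simp: Z_extension_iff intro: path_extension_at_zero)
      have "AE w in Mb. real_cond_exp Mb F (\<lambda>w. min 1 \<bar>Z (\<tau> n) (pr w) 0 - 1\<bar> * \<Psi> (\<tau> n) (pr w)) w = real_cond_exp Mb F (\<lambda>w. 0) w"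
        using 1 by (intro F.real_cond_exp_cong AE_I2) auto
      moreover have "AE w in Mb. real_cond_exp Mb F (\<lambda>w. 0) w = 0" by (rule F.real_cond_exp_F_meas) auto
      ultimately have "AE w in Mb. \<bar>real_cond_exp Mb F (\<lambda>w. min 1 \<bar>Z (\<tau> n) (pr w) 0 - 1\<bar> * \<Psi> (\<tau> n) (pr w)) w
        - real_cond_exp Mb F ?g w\<bar> = \<bar>real_cond_exp Mb F ?g w\<bar>"
        by eventually_elim simp
      then show ?thesis by (intro integral_cong_AE) measurable
    qed
    ultimately have "(\<lambda>n::nat. \<integral>w. \<bar>real_cond_exp Mb F ?g w\<bar> \<partial>Mb) \<longlonglongrightarrow> 0" by simp
    then have z: "(\<integral>w. \<bar>real_cond_exp Mb F ?g w\<bar> \<partial>Mb) = 0" by (simp add: LIMSEQ_const_iff)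
    have i: "integrable Mb ?g" by (rule bounded_prob_integrable[OF Mb, of _ 1]) auto
    have "(\<integral>w. ?g w \<partial>Mb) = (\<integral>w. real_cond_exp Mb F ?g w \<partial>Mb)" using F.real_cond_exp_int(2)[OF i] by simp
    also have "\<dots> \<le> 0" using integral_abs_bound[of Mb "real_cond_exp Mb F ?g"] z by simp
    finally have "(\<integral>w. ?g w \<partial>Mb) = 0" by (intro antisym integral_nonneg_AE) auto
    then have "AE w in Mb. ?g w = 0" using integral_nonneg_eq_0_iff_AE[OF i] by auto
    then show ?thesis by eventually_elim (auto simp: min_def split: if_splits)
  qed
  have path: "AE w in Mb. continuous_on UNIV (apply_bcontfun (Zlim w)) \<and> (apply_bcontfun (Zlim w) \<longlongrightarrow> 0) at_infinity
      \<and> apply_bcontfun (Zlim w) 0 > 0 \<and> (\<forall>v. apply_bcontfun (Zlim w) v \<le> apply_bcontfun (Zlim w) (ulim w))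
      \<and> (\<forall>v. apply_bcontfun (Zlim w) v = apply_bcontfun (Zlim w) (ulim w) \<longrightarrow> v = ulim w)"
    using cond4 zl_0 AE_space
  proof eventually_elim
    case (elim w)
    then have mx: "apply_bcontfun (Zlim w) v \<le> apply_bcontfun (Zlim w) (ulim w)" for v
      by (auto simp: is_arg_max_linorder)
    moreover have "v = ulim w" if "apply_bcontfun (Zlim w) v = apply_bcontfun (Zlim w) (ulim w)" for v
    proof -
      have "is_arg_max (apply_bcontfun (Zlim w)) (\<lambda>_. True) v" using mx that by (simp add: is_arg_max_linorder)
      then show ?thesis using elim(1) by blast
    qed
    ultimately show ?case using elim zl_inf by simp
  qed
  obtain q :: "nat \<Rightarrow> real ^ 'p" where q: "closure (range q) = UNIV" using dense_sequence_exists by blast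

  \<comment> \<open>The approximations required by \<open>cond_exp_limsup_from_above\<close> are
    penalised maxima, at stage \<open>n\<close> of the rescaled field and in the limit of
    \<open>Zlim\<close>. The penalty comes from the limit field, the number of points must suit
    both.\<close>
  have one_sided: "(\<lambda>n. \<integral>w. max 0 (real_cond_exp Mb F (\<lambda>w. f (uh (\<tau> n) (pr w)) * Y (pr w)) w
                       - real_cond_exp Mb F (\<lambda>w. f (ulim w) * Y (pr w)) w) \<partial>Mb) \<longlonglongrightarrow> 0"
    if \<tau>: "\<tau> \<in> admissible_seqs TT T0" and f: "continuous_on UNIV f" "\<And>x. f x \<in> {0..K}"
      and Y: "Y \<in> borel_measurable G" "\<And>\<omega>. \<omega> \<in> space G \<Longrightarrow> Y \<omega> \<in> {0..B}"
    for \<tau> and f :: "real ^ 'p \<Rightarrow> real" and Y K B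
  proof -
    have TT: "\<tau> n \<in> TT" for n using \<tau> by (auto simp: admissible_seqs_def)
    have [measurable]: "f \<in> borel_measurable borel" by (rule borel_measurable_continuous_onI[OF f(1)])
    have [measurable]: "Y \<in> borel_measurable M" by (rule measurable_from_subalg[OF G Y(1)])
    note [measurable] = \<Psi>M[OF TT] uh_meas[OF TT] Z_extension_measurable_section[OF Z_ext[OF TT]]
    have A0: "(\<lambda>n. a (\<tau> n)) \<longlonglongrightarrow> 0" by (rule filterlim_compose[OF a_lim filterlim_admissible[OF \<tau>]])
    show ?thesis
    proof (rule cond_exp_limsup_from_above[OF Mb F, where \<Psi> = "\<lambda>n w. \<Psi> (\<tau> n) (pr w)" and K = K and B = B])
      have "tendsto_in_prob M (\<lambda>n. \<Psi> (\<tau> n)) (\<lambda>\<omega>. 1) sequentially"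
        using cond3ii filterlim_compose[OF _ filterlim_admissible[OF \<tau>]] unfolding tendsto_in_prob_def by blast
      then have "(\<lambda>n. \<integral>\<omega>. \<bar>\<Psi> (\<tau> n) \<omega> - 1\<bar> \<partial>M) \<longlonglongrightarrow> 0"
        by (rule tendsto_in_prob_bounded_imp_L1[OF M, where B = 1])
          (use \<Psi>_range[OF TT] in \<open>auto intro!: always_eventually AE_I2\<close>)
      moreover have "(\<integral>\<omega>. \<bar>\<Psi> (\<tau> n) \<omega> - 1\<bar> \<partial>M) = (\<integral>w. 1 - \<Psi> (\<tau> n) (pr w) \<partial>Mb)" for n
      proof -
        have "(\<integral>\<omega>. \<bar>\<Psi> (\<tau> n) \<omega> - 1\<bar> \<partial>M) = (\<integral>\<omega>. 1 - \<Psi> (\<tau> n) \<omega> \<partial>M)"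
          using \<Psi>_range[OF TT] by (intro Bochner_Integration.integral_cong) auto
        then show ?thesis by (subst transfer) auto
      qed
      ultimately show "(\<lambda>n. \<integral>w. 1 - \<Psi> (\<tau> n) (pr w) \<partial>Mb) \<longlonglongrightarrow> 0" by simp
    next
      fix t :: real assume t: "t > 0"
      obtain b where b: "eventually (\<lambda>m. (\<integral>w. max 0 (penalised_max (\<lambda>i. f (q i)) (real b) m (\<lambda>i. apply_bcontfun (Zlim w) (q i))
          - f (ulim w)) \<partial>Mb) \<le> t) sequentially"
        using penalised_max_limit[OF Mb zl ulim_meas path q f t] by blast
      have "\<exists>m0. \<forall>m\<ge>m0. eventually (\<lambda>n. (\<integral>\<omega>. max 0 (f (uh (\<tau> n) \<omega>)
            - penalised_max (\<lambda>i. f (q i)) (real b) m (\<lambda>i. Z (\<tau> n) \<omega> (q i))) * \<Psi> (\<tau> n) \<omega> \<partial>M) \<le> t) sequentially"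
        unfolding uh_def
        by (rule penalised_max_error_eventually_small[OF M C \<Theta> Z_ext[OF TT] H_cont[OF TT] a_inv[OF TT] A0 qmle[OF TT]
          \<Psi>_meas[OF TT] \<Psi>_range[OF TT] \<open>\<epsilon> \<longlonglongrightarrow> 0\<close> \<open>\<And>r. \<eta> r \<in> borel_measurable M\<close>
          \<open>\<And>r \<omega>. \<omega> \<in> space M \<Longrightarrow> \<eta> r \<omega> > 0\<close> \<open>AE \<omega> in M. (\<lambda>r. \<eta> r \<omega>) \<longlonglongrightarrow> 0\<close>
          cond1[OF \<tau>] cond2[OF _ _ \<tau>] f q of_nat_0_le_iff t])
      then obtain m0 where m0: "\<And>m. m \<ge> m0 \<Longrightarrow> eventually (\<lambda>n. (\<integral>\<omega>. max 0 (f (uh (\<tau> n) \<omega>)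
            - penalised_max (\<lambda>i. f (q i)) (real b) m (\<lambda>i. Z (\<tau> n) \<omega> (q i))) * \<Psi> (\<tau> n) \<omega> \<partial>M) \<le> t) sequentially"
        by blast
      obtain m1 where m1: "\<And>m. m \<ge> m1 \<Longrightarrow> (\<integral>w. max 0 (penalised_max (\<lambda>i. f (q i)) (real b) m
          (\<lambda>i. apply_bcontfun (Zlim w) (q i)) - f (ulim w)) \<partial>Mb) \<le> t"
        using b unfolding eventually_sequentially by blast
      define m where "m = max m0 m1"
      have m: "m \<ge> m0" "m \<ge> m1" by (simp_all add: m_def)
      let ?P = "penalised_max (\<lambda>i. f (q i)) (real b) m"
      have P: "?P x \<in> {0..K}" for x by (rule penalised_max_bounds) (use f in auto)
      have pm[measurable]: "(\<lambda>\<omega>. ?P (\<lambda>i. Z (\<tau> n) \<omega> (q i))) \<in> borel_measurable M" for n unfolding penalised_max_def by measurable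
      have lm: "(\<lambda>w. ?P (\<lambda>i. apply_bcontfun (Zlim w) (q i))) \<in> borel_measurable Mb" unfolding penalised_max_def by measurable
      have pm': "(\<lambda>w. ?P (\<lambda>i. Z (\<tau> n) (pr w) (q i))) \<in> borel_measurable Mb" for n
        by (rule measurable_compose[OF pr pm])
      have tr: "(\<integral>w. max 0 (f (uh (\<tau> n) (pr w)) - ?P (\<lambda>i. Z (\<tau> n) (pr w) (q i))) * \<Psi> (\<tau> n) (pr w) \<partial>Mb)
          = (\<integral>\<omega>. max 0 (f (uh (\<tau> n) \<omega>) - ?P (\<lambda>i. Z (\<tau> n) \<omega> (q i))) * \<Psi> (\<tau> n) \<omega> \<partial>M)" for n
        by (rule transfer) measurable
      have "(\<lambda>n. \<integral>w. \<bar>real_cond_exp Mb F (\<lambda>w. ?P (\<lambda>i. Z (\<tau> n) (pr w) (q i)) * \<Psi> (\<tau> n) (pr w) * Y (pr w)) w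
           - real_cond_exp Mb F (\<lambda>w. ?P (\<lambda>i. apply_bcontfun (Zlim w) (q i)) * Y (pr w)) w\<bar> \<partial>Mb) \<longlonglongrightarrow> 0"
        using fidi[OF \<tau> continuous_on_penalised_max P Y, of "Suc m" q] by (simp only: penalised_max_truncate)
      then show "\<exists>\<phi> \<phi>l. (\<forall>n. \<phi> n \<in> borel_measurable Mb) \<and> \<phi>l \<in> borel_measurable Mb \<and>
        (\<forall>w. (\<forall>n. \<phi> n w \<in> {0..K}) \<and> \<phi>l w \<in> {0..K}) \<and>
        eventually (\<lambda>n. (\<integral>w. max 0 (f (uh (\<tau> n) (pr w)) - \<phi> n w) * \<Psi> (\<tau> n) (pr w) \<partial>Mb) \<le> t) sequentially \<and>
        (\<lambda>n. \<integral>w. \<bar>real_cond_exp Mb F (\<lambda>w. \<phi> n w * \<Psi> (\<tau> n) (pr w) * Y (pr w)) w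
                  - real_cond_exp Mb F (\<lambda>w. \<phi>l w * Y (pr w)) w\<bar> \<partial>Mb) \<longlonglongrightarrow> 0 \<and>
        (\<integral>w. max 0 (\<phi>l w - f (ulim w)) \<partial>Mb) \<le> t"
        using P lm pm' m0[OF m(1)] m1[OF m(2)] tr
        by (intro exI[of _ "\<lambda>n w. ?P (\<lambda>i. Z (\<tau> n) (pr w) (q i))"] exI[of _ "\<lambda>w. ?P (\<lambda>i. apply_bcontfun (Zlim w) (q i))"] conjI)
          auto
    qed (use f Y \<Psi>_range[OF TT prs] prs sp in auto)
  qed

  \<comment> \<open>\<open>D\<close> is integrated in two ways: its absolute value gives convergence
    in probability, \<open>D\<close> itself gives stable convergence.\<close>
  define D where "D f Y T w = real_cond_exp M C (\<lambda>\<omega>. f (uh T \<omega>) * Y \<omega>) (pr w)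
      - ext_cond_exp Mb pr C (\<lambda>w. f (ulim w) * Y (pr w)) w" for f :: "real ^ 'p \<Rightarrow> real" and Y T w
  have int: "integrable M (\<lambda>\<omega>. f (uh T \<omega>) * Y \<omega>)" "integrable Mb (\<lambda>w. f (ulim w) * Y (pr w))"
    if f: "continuous_on UNIV f" "bounded (range f)" and Y: "Y \<in> borel_measurable G" "bounded (Y ` space G)" and T: "T \<in> TT"
    for f :: "real ^ 'p \<Rightarrow> real" and Y T
  proof -
    have [measurable]: "f \<in> borel_measurable borel" by (rule borel_measurable_continuous_onI[OF f(1)])
    have [measurable]: "Y \<in> borel_measurable M" by (rule measurable_from_subalg[OF G Y(1)])
    note [measurable] = uh_meas[OF T]
    obtain K where K: "\<And>x. \<bar>f x\<bar> \<le> K" using f(2) by (auto simp: bounded_iff)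
    obtain B where B: "\<And>x. x \<in> space M \<Longrightarrow> \<bar>Y x\<bar> \<le> B" using Y(2) sp by (auto simp: bounded_iff)
    have "0 \<le> K" using K[of 0] by linarith
    then have "\<bar>f x * Y \<omega>\<bar> \<le> K * B" if "\<omega> \<in> space M" for x \<omega>
      unfolding abs_mult using K B[OF that] by (intro mult_mono) auto
    then show "integrable M (\<lambda>\<omega>. f (uh T \<omega>) * Y \<omega>)" "integrable Mb (\<lambda>w. f (ulim w) * Y (pr w))"
      by (auto intro!: bounded_prob_integrable[OF M, of _ "K * B"] bounded_prob_integrable[OF Mb, of _ "K * B"] prs)
  qed
  have Dint: "integrable Mb (D f Y T)" "(\<integral>w. D f Y T w \<partial>Mb) = (\<integral>\<omega>. f (uh T \<omega>) * Y \<omega> \<partial>M) - (\<integral>w. f (ulim w) * Y (pr w) \<partial>Mb)"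
    "AE w in Mb. D f Y T w = real_cond_exp Mb F (\<lambda>w. f (uh T (pr w)) * Y (pr w)) w - real_cond_exp Mb F (\<lambda>w. f (ulim w) * Y (pr w)) w"
    if f: "continuous_on UNIV f" "bounded (range f)" and Y: "Y \<in> borel_measurable G" "bounded (Y ` space G)" and T: "T \<in> TT"
    for f :: "real ^ 'p \<Rightarrow> real" and Y T
  proof -
    interpret C: sigma_finite_subalgebra M C by (rule prob_space_imp_sigma_finite_subalgebra[OF M C])
    note i = int[OF that]
    note c = C.real_cond_exp_int[OF i(1)] and l = F.real_cond_exp_int[OF i(2)]
    have c': "integrable Mb (\<lambda>w. real_cond_exp M C (\<lambda>\<omega>. f (uh T \<omega>) * Y \<omega>) (pr w))"
      using integrable_distr[OF pr, of "real_cond_exp M C (\<lambda>\<omega>. f (uh T \<omega>) * Y \<omega>)"] c(1) distr by simp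
    show "integrable Mb (D f Y T)" unfolding D_def[abs_def] ext_cond_exp_def using c' l(1) by (simp add: F_def)
    have "(\<integral>w. real_cond_exp M C (\<lambda>\<omega>. f (uh T \<omega>) * Y \<omega>) (pr w) \<partial>Mb) = (\<integral>\<omega>. f (uh T \<omega>) * Y \<omega> \<partial>M)"
      using c by (subst transfer) auto
    then show "(\<integral>w. D f Y T w \<partial>Mb) = (\<integral>\<omega>. f (uh T \<omega>) * Y \<omega> \<partial>M) - (\<integral>w. f (ulim w) * Y (pr w) \<partial>Mb)"
      unfolding D_def ext_cond_exp_def using c' l by (simp add: F_def)
    show "AE w in Mb. D f Y T w = real_cond_exp Mb F (\<lambda>w. f (uh T (pr w)) * Y (pr w)) w - real_cond_exp Mb F (\<lambda>w. f (ulim w) * Y (pr w)) w"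
      using real_cond_exp_pullback[OF M ext C i(1)] by (simp add: D_def ext_cond_exp_def F_def)
  qed
  have L1: "((\<lambda>T. \<integral>w. \<bar>D f Y T w\<bar> \<partial>Mb) \<longlongrightarrow> 0) (at_top_in TT)"
    if fY: "continuous_on UNIV f" "bounded (range f)" "Y \<in> borel_measurable G" "bounded (Y ` space G)"
    for f :: "real ^ 'p \<Rightarrow> real" and Y
  proof (rule tendsto_at_top_in_if_admissible)
    fix \<tau> assume \<tau>: "\<tau> \<in> admissible_seqs TT T0"
    then have TT: "\<tau> n \<in> TT" for n by (auto simp: admissible_seqs_def)
    note [measurable] = uh_meas[OF TT]
    have "(\<lambda>n. \<integral>w. \<bar>real_cond_exp Mb F (\<lambda>w. f (uh (\<tau> n) (pr w)) * Y (pr w)) w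
        - real_cond_exp Mb F (\<lambda>w. f (ulim w) * Y (pr w)) w\<bar> \<partial>Mb) \<longlonglongrightarrow> 0"
      by (rule real_cond_exp_L1_if_one_sided[where U = "\<lambda>n w. uh (\<tau> n) (pr w)", OF Mb F _ ulim_meas prG one_sided[OF \<tau>] fY]) measurable
    moreover have "(\<integral>w. \<bar>D f Y (\<tau> n) w\<bar> \<partial>Mb) = (\<integral>w. \<bar>real_cond_exp Mb F (\<lambda>w. f (uh (\<tau> n) (pr w)) * Y (pr w)) w
        - real_cond_exp Mb F (\<lambda>w. f (ulim w) * Y (pr w)) w\<bar> \<partial>Mb)" for n
      using Dint(1,3)[OF fY TT, of n] by (intro integral_cong_AE) auto
    ultimately show "(\<lambda>n. \<integral>w. \<bar>D f Y (\<tau> n) w\<bar> \<partial>Mb) \<longlonglongrightarrow> 0" by simp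
  qed
  have inTT: "eventually (\<lambda>T. T \<in> TT) (at_top_in TT)" by (simp add: eventually_inf_principal)
  show ?thesis
    unfolding stable_conv_def
  proof (intro conjI allI impI)
    fix f :: "real ^ 'p \<Rightarrow> real" and Y :: "'a \<Rightarrow> real"
    assume fY: "continuous_on UNIV f" "bounded (range f)" "Y \<in> borel_measurable G" "bounded (Y ` space G)"
    show "tendsto_in_prob Mb (\<lambda>T w. real_cond_exp M C (\<lambda>\<omega>. f (uh T \<omega>) * Y \<omega>) (pr w))
              (ext_cond_exp Mb pr C (\<lambda>w. f (ulim w) * Y (pr w))) (at_top_in TT)"
    proof (rule L1_imp_tendsto_in_prob)
      show "((\<lambda>T. \<integral>w. \<bar>real_cond_exp M C (\<lambda>\<omega>. f (uh T \<omega>) * Y \<omega>) (pr w)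
         - ext_cond_exp Mb pr C (\<lambda>w. f (ulim w) * Y (pr w)) w\<bar> \<partial>Mb) \<longlongrightarrow> 0) (at_top_in TT)"
        using L1[OF fY] by (simp add: D_def)
      show "eventually (\<lambda>T. integrable Mb (\<lambda>w. real_cond_exp M C (\<lambda>\<omega>. f (uh T \<omega>) * Y \<omega>) (pr w)
         - ext_cond_exp Mb pr C (\<lambda>w. f (ulim w) * Y (pr w)) w)) (at_top_in TT)"
        using inTT by eventually_elim (use Dint(1)[OF fY] in \<open>simp add: D_def[abs_def]\<close>)
    qed
    show "((\<lambda>T. \<integral>\<omega>. f (uh T \<omega>) * Y \<omega> \<partial>M) \<longlongrightarrow> (\<integral>w. f (ulim w) * Y (pr w) \<partial>Mb)) (at_top_in TT)"
    proof (rule Lim_null[THEN iffD2], rule Lim_null_comparison[OF _ L1[OF fY]])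
      show "eventually (\<lambda>T. norm ((\<integral>\<omega>. f (uh T \<omega>) * Y \<omega> \<partial>M) - (\<integral>w. f (ulim w) * Y (pr w) \<partial>Mb))
          \<le> (\<integral>w. \<bar>D f Y T w\<bar> \<partial>Mb)) (at_top_in TT)"
        using inTT
      proof eventually_elim
        case (elim T)
        show ?case unfolding Dint(2)[OF fY elim, symmetric] by (simp add: integral_abs_bound)
      qed
    qed
  qed
qed

end
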